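(* Let $\Omega \subseteq \mathbb{C}^2$ be a smoothly bounded, convex domain. Let $P \in \partial\Omega$ and assume that, in a neighborhood $U$ of $P$, $\partial\Omega$ coincides with a real hyperplane in $\mathbb{C}^2$ (so that in suitable local coordinates $\partial\Omega \cap U = \{z \in U : \operatorname{Re} z_1 = 0\}$). If $P$ is a boundary orbit accumulation point for $\Omega$, then $\Omega$ is biholomorphic to the bidisc $D \times D$.
   Context: A domain in $\mathbb{C}^n$ is a connected open set; smoothly bounded means bounded with $C^\infty$ boundary. $D$ is the open unit disc in $\mathbb{C}$. A point $P \in \partial\Omega$ is a boundary orbit accumulation point if there are a point $X \in \Omega$ and automorphisms (biholomorphic self-maps) $\varphi_j: \Omega \to \Omega$ with $\varphi_j(X) \to P$ as $j \to \infty$. *)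

theory Defs
  imports "HOL-Analysis.Analysis"
begin

section \<open>Holomorphic maps between open subsets of complex coordinate spaces\<close>

text \<open>
  The type \<open>complex ^ 'n\<close> carries only a real normed vector space structure in the library, so
  \<open>has_derivative\<close> refers to the real Frechet derivative. Holomorphy asks that this derivative
  be linear for the complex scalar multiplication \<open>*s\<close>. The definitions are meant for open \<open>S\<close>.
\<close>

definition holomorphic_map_on :: "(complex ^ 'n \<Rightarrow> complex ^ 'm) \<Rightarrow> (complex ^ 'n) set \<Rightarrow> bool"
  where "holomorphic_map_on f S \<longleftrightarrow>
    (\<forall>z\<in>S. \<exists>f'. (f has_derivative f') (at z) \<and> Vector_Spaces.linear (*s) (*s) f')"

definition biholomorphism ::
    "(complex ^ 'n) set \<Rightarrow> (complex ^ 'm) set \<Rightarrow> (complex ^ 'n \<Rightarrow> complex ^ 'm) \<Rightarrow> bool"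
  where "biholomorphism S T f \<longleftrightarrow>
    bij_betw f S T \<and> holomorphic_map_on f S \<and> holomorphic_map_on (inv_into S f) T"

definition biholomorphic :: "(complex ^ 'n) set \<Rightarrow> (complex ^ 'm) set \<Rightarrow> bool"
  where "biholomorphic S T \<longleftrightarrow> (\<exists>f. biholomorphism S T f)"

definition bidisc :: "(complex ^ 2) set"
  where "bidisc = {z. z $ 1 \<in> ball 0 1 \<and> z $ 2 \<in> ball 0 1}"

section \<open>Domains with smooth boundary\<close>

definition is_domain :: "(complex ^ 'n) set \<Rightarrow> bool"
  where "is_domain \<Omega> \<longleftrightarrow> open \<Omega> \<and> connected \<Omega>"

text \<open>\<open>Ck_on k f S\<close>: \<open>f\<close> is \<open>k\<close> times continuously (real) differentiable on the open set \<open>S\<close>.\<close>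

primrec Ck_on :: "nat \<Rightarrow> ('a::real_normed_vector \<Rightarrow> 'b::real_normed_vector) \<Rightarrow> 'a set \<Rightarrow> bool"
  where
    "Ck_on 0 f S \<longleftrightarrow> continuous_on S f"
  | "Ck_on (Suc k) f S \<longleftrightarrow>
       (\<forall>x\<in>S. f differentiable (at x)) \<and> (\<forall>v. Ck_on k (\<lambda>x. frechet_derivative f (at x) v) S)"

definition Cinf_on :: "('a::real_normed_vector \<Rightarrow> 'b::real_normed_vector) \<Rightarrow> 'a set \<Rightarrow> bool"
  where "Cinf_on f S \<longleftrightarrow> (\<forall>k. Ck_on k f S)"

text \<open>
  Smoothness of the boundary of an open set is expressed by local defining functions \<open>r\<close> with
  nowhere vanishing differential. For open \<open>\<Omega>\<close> this entails that
  \<open>frontier \<Omega> \<inter> U = {z \<in> U. r z = 0}\<close>.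
\<close>

definition smooth_boundary :: "'a::euclidean_space set \<Rightarrow> bool"
  where "smooth_boundary \<Omega> \<longleftrightarrow>
    (\<forall>p\<in>frontier \<Omega>. \<exists>U r. open U \<and> p \<in> U \<and> Cinf_on (r :: 'a \<Rightarrow> real) U \<and>
       (\<forall>z\<in>U. frechet_derivative r (at z) \<noteq> (\<lambda>v. 0)) \<and>
       \<Omega> \<inter> U = {z \<in> U. r z < 0})"

definition smoothly_bounded :: "'a::euclidean_space set \<Rightarrow> bool"
  where "smoothly_bounded \<Omega> \<longleftrightarrow> bounded \<Omega> \<and> smooth_boundary \<Omega>"

section \<open>Local geometry and orbits at a boundary point\<close>

text \<open>
  On \<open>complex ^ 'n\<close> the inner product \<open>\<bullet>\<close> is the real one, i.e. the real part of the standard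
  Hermitian product, so the sets \<open>{z. a \<bullet> z = b}\<close> with \<open>a \<noteq> 0\<close> are exactly the real
  (affine) hyperplanes.
\<close>

definition boundary_flat_near :: "'a::euclidean_space set \<Rightarrow> 'a \<Rightarrow> bool"
  where "boundary_flat_near \<Omega> P \<longleftrightarrow>
    (\<exists>U a b. open U \<and> P \<in> U \<and> a \<noteq> 0 \<and> frontier \<Omega> \<inter> U = {z. a \<bullet> z = b} \<inter> U)"

definition boundary_orbit_accumulation_point :: "(complex ^ 'n) set \<Rightarrow> complex ^ 'n \<Rightarrow> bool"
  where "boundary_orbit_accumulation_point \<Omega> P \<longleftrightarrow>
    P \<in> frontier \<Omega> \<and>
    (\<exists>X\<in>\<Omega>. \<exists>\<phi> :: nat \<Rightarrow> complex ^ 'n \<Rightarrow> complex ^ 'n.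
       (\<forall>j. biholomorphism \<Omega> \<Omega> (\<phi> j)) \<and> (\<lambda>j. \<phi> j X) \<longlonglongrightarrow> P)"

end

theory Submission
  imports Defs "HOL-Complex_Analysis.Riemann_Mapping"
begin

text \<open>
  The proof is a scaling argument along the orbit. Put \<open>P\<close> at the origin and let \<open>\<Omega>\<close> lie in the
  half-space \<open>Re z\<^sub>1 > 0\<close>, so that the boundary is \<open>Re z\<^sub>1 = 0\<close> near the origin. The points
  \<open>p\<^sub>j = \<phi>\<^sub>j(x)\<close> of the orbit tend to the origin. Stretch the first coordinate by the affine map that
  sends \<open>Re z\<^sub>1 > 0\<close> to itself and the first coordinate of \<open>p\<^sub>j\<close> to \<open>1\<close>, and leave \<open>z\<^sub>2\<close> alone. The
  stretched domains all lie in \<open>Re z\<^sub>1 > 0\<close>, and they converge to the product of this half-plane with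
  the interior of the convex set \<open>E = {w. (0, w) \<in> closure \<Omega>}\<close>. Convexity gives the part of this
  convergence that needs proof (\<open>near_face_interior\<close>): every point \<open>(0, w)\<close> with \<open>w\<close> in the interior
  of \<open>E\<close> has a neighbourhood whose part in \<open>Re z\<^sub>1 > 0\<close> lies in \<open>\<Omega>\<close>.

  The automorphisms \<open>\<phi>\<^sub>j\<close> followed by the stretchings are biholomorphisms from \<open>\<Omega>\<close> onto the stretched
  domains. A Riemann map of the half-plane in the first coordinate turns them into bounded maps \<open>F\<^sub>j\<close>,
  whose inverses \<open>G\<^sub>j\<close> take values in the bounded set \<open>\<Omega>\<close>. By Montel's theorem (\<open>Montel_pointwise\<close>) a subsequence
  of both families converges. The limits map \<open>\<Omega>\<close> and the product domain into the closures of each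
  other, and each takes a value in the interior: the points \<open>F\<^sub>j x\<close> converge inside the product domain,
  and \<open>G\<^sub>j\<close> sends them back to \<open>x\<close>. The maximum principle for convex targets
  (\<open>holomorphic_map_on_interior_of_convex\<close>) then keeps the limits inside the open sets. Local
  equicontinuity (\<open>tendsto_at_moving_point\<close>) lets the relations \<open>G\<^sub>j (F\<^sub>j z) = z\<close> and
  \<open>F\<^sub>j (G\<^sub>j u) = u\<close> pass to the limit, so \<open>\<Omega>\<close> is biholomorphic to the product. The interior of \<open>E\<close> is a
  bounded convex plane domain, and the Riemann mapping theorem turns it into a disc.

  Convergence is handled as pointwise convergence together with a local uniform Lipschitz bound from
  the Cauchy estimate (\<open>cauchy_estimate\<close>), which reduces everything in several variables to one
  variable on complex lines.
\<close>

(* Here $ always selects a component of a vector, never a coefficient of a power series. *)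
unbundle no fps_syntax

section \<open>Calculus of holomorphic maps\<close>

lemma holomorphic_map_onI:
  assumes "\<And>z. z \<in> S \<Longrightarrow> (f has_derivative f' z) (at z)"
    and "\<And>z c h. z \<in> S \<Longrightarrow> f' z (c *s h) = c *s f' z h"
  shows "holomorphic_map_on f S"
  unfolding holomorphic_map_on_def
proof
  fix z assume z: "z \<in> S"
  have "linear (f' z)"
    using assms(1)[OF z] has_derivative_linear by blast
  then have "Vector_Spaces.linear (*s) (*s) (f' z)"
    using assms(2)[OF z]
    by (simp add: Vector_Spaces.linear_iff vec.vector_space_axioms linear_add)
  then show "\<exists>f'. (f has_derivative f') (at z) \<and> Vector_Spaces.linear (*s) (*s) f'"
    using assms(1)[OF z] by blast
qed

lemma holomorphic_map_onE:
  assumes "holomorphic_map_on f S" and "z \<in> S"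
  obtains f' where "(f has_derivative f') (at z)" and "\<And>c h. f' (c *s h) = c *s f' h"
  using assms unfolding holomorphic_map_on_def Vector_Spaces.linear_iff by metis

lemma holomorphic_map_on_subset:
  "holomorphic_map_on f S \<Longrightarrow> T \<subseteq> S \<Longrightarrow> holomorphic_map_on f T"
  unfolding holomorphic_map_on_def by blast

lemma holomorphic_map_on_cong:
  assumes "open S" and "holomorphic_map_on f S" and "\<And>z. z \<in> S \<Longrightarrow> f z = g z"
  shows "holomorphic_map_on g S"
  using assms unfolding holomorphic_map_on_def
  by (metis has_derivative_transform_within_open)

lemma holomorphic_map_on_compose:
  assumes "holomorphic_map_on f S" and "holomorphic_map_on g T" and "f ` S \<subseteq> T"
  shows "holomorphic_map_on (g \<circ> f) S"
  unfolding holomorphic_map_on_def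
proof
  fix z assume z: "z \<in> S"
  obtain f' where f': "(f has_derivative f') (at z)" "Vector_Spaces.linear (*s) (*s) f'"
    using assms(1) z unfolding holomorphic_map_on_def by blast
  obtain g' where g': "(g has_derivative g') (at (f z))" "Vector_Spaces.linear (*s) (*s) g'"
    using assms(2,3) z unfolding holomorphic_map_on_def by blast
  show "\<exists>h'. (g \<circ> f has_derivative h') (at z) \<and> Vector_Spaces.linear (*s) (*s) h'"
    using diff_chain_at[OF f'(1) g'(1)] Vector_Spaces.linear_compose[OF f'(2) g'(2)] by blast
qed

lemma holomorphic_map_on_diff:
  assumes "holomorphic_map_on f S" and "holomorphic_map_on g S"
  shows "holomorphic_map_on (\<lambda>z. f z - g z) S"
  unfolding holomorphic_map_on_def
proof
  fix z assume z: "z \<in> S"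
  obtain f' g' where "(f has_derivative f') (at z)" "Vector_Spaces.linear (*s) (*s) f'"
    "(g has_derivative g') (at z)" "Vector_Spaces.linear (*s) (*s) g'"
    using assms z unfolding holomorphic_map_on_def by meson
  then show "\<exists>h'. ((\<lambda>z. f z - g z) has_derivative h') (at z) \<and> Vector_Spaces.linear (*s) (*s) h'"
    by (intro exI[of _ "\<lambda>h. f' h - g' h"] conjI has_derivative_diff vec.linear_compose_sub)
qed

text \<open>
  The Euclidean basis of \<open>'b ^ 'n\<close> refines the coordinates, so it is enough to differentiate each
  component as a map into \<open>'b\<close>.
\<close>

lemma has_derivative_componentwise_cart:
  fixes f :: "'a::real_normed_vector \<Rightarrow> 'b::euclidean_space ^ 'n"
  assumes "\<And>i. ((\<lambda>x. f x $ i) has_derivative (\<lambda>h. f' h $ i)) F" and "F = at x within S"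
  shows "(f has_derivative f') F"
  unfolding assms(2)
proof (subst has_derivative_componentwise_within, rule ballI)
  fix b :: "'b ^ 'n" assume "b \<in> Basis"
  then obtain i u where b: "b = axis i u"
    by (auto simp: Basis_vec_def)
  show "((\<lambda>x. f x \<bullet> b) has_derivative (\<lambda>x. f' x \<bullet> b)) (at x within S)"
    using assms(1)[of i] unfolding b inner_axis assms(2)
    by (rule has_derivative_inner_left)
qed

lemma holomorphic_map_on_pair:
  fixes p s :: "complex \<Rightarrow> complex"
  assumes p: "p holomorphic_on A" and s: "s holomorphic_on B" and "open A" and "open B"
  shows "holomorphic_map_on (\<lambda>z :: complex ^ 2. vector [p (z $ 1), s (z $ 2)] :: complex ^ 2)
           {z. z $ 1 \<in> A \<and> z $ 2 \<in> B}"
proof (rule holomorphic_map_onI)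
  fix z :: "complex ^ 2" assume z: "z \<in> {z. z $ 1 \<in> A \<and> z $ 2 \<in> B}"
  have comp: "((\<lambda>z :: complex ^ 2. q (z $ i)) has_derivative (\<lambda>h. deriv q (z $ i) * h $ i)) (at z)"
    if "q holomorphic_on C" "open C" "z $ i \<in> C" for q C and i :: 2
  proof -
    have "(q has_derivative (*) (deriv q (z $ i))) (at (z $ i))"
      using holomorphic_derivI[OF that] by (simp add: has_field_derivative_def)
    moreover have "((\<lambda>z. z $ i) has_derivative (\<lambda>h. h $ i)) (at z)"
      by (rule bounded_linear_imp_has_derivative) (rule bounded_linear_vec_nth)
    ultimately show ?thesis
      using diff_chain_at[of "\<lambda>z. z $ i" "\<lambda>h. h $ i" z q] by (simp add: o_def)
  qed
  show "((\<lambda>z :: complex ^ 2. vector [p (z $ 1), s (z $ 2)] :: complex ^ 2) has_derivative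
      (\<lambda>h. vector [deriv p (z $ 1) * h $ 1, deriv s (z $ 2) * h $ 2])) (at z)"
  proof (rule has_derivative_componentwise_cart[OF _ refl])
    fix i :: 2
    have "i = 1 \<or> i = 2" by (rule exhaust_2)
    then show "((\<lambda>z. (vector [p (z $ 1), s (z $ 2)] :: complex ^ 2) $ i) has_derivative
      (\<lambda>h. (vector [deriv p (z $ 1) * h $ 1, deriv s (z $ 2) * h $ 2] :: complex ^ 2) $ i)) (at z)"
      using comp[OF p \<open>open A\<close>, of 1] comp[OF s \<open>open B\<close>, of 2] z by auto
  qed
next
  fix z h :: "complex ^ 2" and c :: complex
  show "vector [deriv p (z $ 1) * (c *s h) $ 1, deriv s (z $ 2) * (c *s h) $ 2] =
     c *s (vector [deriv p (z $ 1) * h $ 1, deriv s (z $ 2) * h $ 2] :: complex ^ 2)"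
    by (simp add: vec_eq_iff forall_2)
qed

lemma holomorphic_map_on_imp_continuous_on:
  "holomorphic_map_on f S \<Longrightarrow> continuous_on S f"
  unfolding holomorphic_map_on_def
  by (metis continuous_at_imp_continuous_on has_derivative_continuous)

lemma has_derivative_scale_complex:
  "((\<lambda>\<zeta>. z + \<zeta> *s v) has_derivative (\<lambda>d. d *s v)) (at (\<zeta>\<^sub>0 :: complex))"
proof (rule has_derivative_componentwise_cart[OF _ refl])
  fix i
  show "((\<lambda>\<zeta>. (z + \<zeta> *s v) $ i) has_derivative (\<lambda>d. (d *s v) $ i)) (at \<zeta>\<^sub>0)"
    by (auto intro!: derivative_eq_intros)
qed

text \<open>
  On the complex line through \<open>z\<close> in direction \<open>v\<close>, complex linearity of the Frechet derivative is
  exactly the Cauchy-Riemann equation. The lemma opens the way to one-variable theory.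
\<close>

lemma has_field_derivative_slice:
  fixes f :: "complex ^ 'n \<Rightarrow> complex ^ 'm"
  assumes "(f has_derivative f') (at (z + \<zeta> *s v))" and "\<And>c h. f' (c *s h) = c *s f' h"
  shows "((\<lambda>\<zeta>. f (z + \<zeta> *s v) $ i) has_field_derivative f' v $ i) (at \<zeta>)"
proof -
  have "((\<lambda>\<zeta>. f (z + \<zeta> *s v)) has_derivative (\<lambda>d. f' (d *s v))) (at \<zeta>)"
    using diff_chain_at[OF has_derivative_scale_complex assms(1)] by (simp add: o_def)
  then have "((\<lambda>\<zeta>. f (z + \<zeta> *s v) $ i) has_derivative (\<lambda>d. f' (d *s v) $ i)) (at \<zeta>)"
    by (rule bounded_linear.has_derivative[OF bounded_linear_vec_nth])
  moreover have "(\<lambda>d. f' (d *s v) $ i) = (*) (f' v $ i)"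
    by (auto simp: assms(2))
  ultimately show ?thesis
    by (simp add: has_field_derivative_def)
qed

lemma holomorphic_on_slice:
  fixes f :: "complex ^ 'n \<Rightarrow> complex ^ 'm"
  assumes "holomorphic_map_on f S"
  shows "(\<lambda>\<zeta>. f (z + \<zeta> *s v) $ i) holomorphic_on {\<zeta>. z + \<zeta> *s v \<in> S}"
  unfolding holomorphic_on_def
proof
  fix \<zeta> assume "\<zeta> \<in> {\<zeta>. z + \<zeta> *s v \<in> S}"
  then have "z + \<zeta> *s v \<in> S" by simp
  with assms obtain f' where "(f has_derivative f') (at (z + \<zeta> *s v))" "\<And>c h. f' (c *s h) = c *s f' h"
    by (rule holomorphic_map_onE) blast
  then have "((\<lambda>\<zeta>. f (z + \<zeta> *s v) $ i) has_field_derivative f' v $ i) (at \<zeta>)"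
    by (rule has_field_derivative_slice)
  then show "(\<lambda>\<zeta>. f (z + \<zeta> *s v) $ i) field_differentiable at \<zeta> within {\<zeta>. z + \<zeta> *s v \<in> S}"
    using field_differentiable_def field_differentiable_at_within by blast
qed

lemma norm_vector_scalar_mult:
  "norm ((c :: complex) *s v) = norm c * norm v"
proof -
  have "norm ((c :: complex) *s v) = L2_set (\<lambda>i. norm c * norm (v $ i)) UNIV"
    by (simp add: norm_vec_def norm_mult)
  then show ?thesis
    by (simp add: L2_set_right_distrib norm_vec_def)
qed

lemma norm_le_card_mult_component:
  fixes x :: "'a::real_normed_vector ^ 'n" and B :: real
  assumes "\<And>i. norm (x $ i) \<le> B"
  shows "norm x \<le> CARD('n) * B"
proof -
  have "norm x \<le> (\<Sum>i\<in>UNIV. norm (x $ i))"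
    unfolding norm_vec_def by (rule L2_set_le_sum) simp
  also have "\<dots> \<le> (\<Sum>i\<in>(UNIV :: 'n set). B)"
    by (rule sum_mono) (rule assms)
  finally show ?thesis by simp
qed

text \<open>
  In each component this is the one-variable Cauchy inequality on the complex line through \<open>z\<close> in
  direction \<open>h\<close>. The constants are not sharp: one factor 2 comes from stopping at half the
  radius, another from replacing the closed bound \<open>B\<close> by an open one, and the cardinality from
  passing from components to the norm.
\<close>

lemma cauchy_estimate:
  fixes f :: "complex ^ 'n \<Rightarrow> complex ^ 'm"
  assumes hol: "holomorphic_map_on f (ball z r)" and "0 < r"
    and bd: "\<And>w. w \<in> ball z r \<Longrightarrow> norm (f w) \<le> B"
    and f': "(f has_derivative f') (at z)"
  shows "norm (f' h) \<le> CARD('m) * (4 * B / r) * norm h"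
proof (cases "h = 0")
  case True
  have "f' 0 = 0"
    using f' by (metis has_derivative_linear linear_0)
  with True show ?thesis by simp
next
  case False
  have "0 \<le> B" using bd[of z] \<open>0 < r\<close> norm_ge_zero order_trans by (metis centre_in_ball)
  have lin: "f' (c *s h) = c *s f' h" for c h
  proof -
    obtain g' where g': "(f has_derivative g') (at z)" "\<And>c h. g' (c *s h) = c *s g' h"
      using hol \<open>0 < r\<close> by (metis holomorphic_map_onE centre_in_ball)
    then have "g' = f'" using f' by (metis has_derivative_unique)
    with g' show ?thesis by simp
  qed
  \<comment> \<open>the line parameter \<open>s\<close> corresponds to distance \<open>r / 2\<close> in direction \<open>h\<close>\<close>
  define s where "s = r / (2 * norm h)"
  have s: "0 < s" using False \<open>0 < r\<close> by (simp add: s_def)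
  have inside: "z + \<zeta> *s h \<in> ball z r" if "\<zeta> \<in> cball 0 s" for \<zeta>
  proof -
    have "norm (\<zeta> *s h) \<le> s * norm h"
      using that by (simp add: norm_vector_scalar_mult mult_right_mono)
    also have "\<dots> < r" using False \<open>0 < r\<close> by (simp add: s_def)
    finally show ?thesis by (simp add: dist_norm)
  qed
  have comp: "norm (f' h $ i) \<le> (4 * B / r) * norm h" if "0 < B" for i
  proof -
    let ?g = "\<lambda>\<zeta>. f (z + \<zeta> *s h) $ i"
    have holg: "?g holomorphic_on cball 0 s"
      by (rule holomorphic_on_subset[OF holomorphic_on_slice[OF hol]]) (use inside in auto)
    have "norm ((deriv ^^ 1) ?g 0) \<le> fact 1 * (2 * B) / s ^ 1"
    proof (rule Cauchy_higher_deriv_bound)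
      show "?g holomorphic_on ball 0 s" using holg holomorphic_on_subset by (metis ball_subset_cball)
      show "continuous_on (cball 0 s) ?g" using holg by (rule holomorphic_on_imp_continuous_on)
      show "?g \<zeta> \<in> ball 0 (2 * B)" if "\<zeta> \<in> ball 0 s" for \<zeta>
      proof -
        have "norm (?g \<zeta>) \<le> norm (f (z + \<zeta> *s h))" by (rule Finite_Cartesian_Product.norm_nth_le)
        also have "\<dots> \<le> B" using that by (intro bd inside) simp
        finally show ?thesis using \<open>0 < B\<close> by simp
      qed
    qed (use s in auto)
    moreover have "deriv ?g 0 = f' h $ i"
      by (rule DERIV_imp_deriv, rule has_field_derivative_slice) (use f' lin in auto)
    ultimately show ?thesis using False \<open>0 < r\<close> by (simp add: s_def field_simps)
  qed
  show ?thesis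
  proof (cases "B = 0")
    case True
    have "f' h = 0"
    proof -
      have "((\<lambda>_. 0) has_derivative f') (at z)"
        by (rule has_derivative_transform_within_open[OF f', of "ball z r"])
           (use bd True \<open>0 < r\<close> in auto)
      then have "f' = (\<lambda>_. 0)" using has_derivative_const has_derivative_unique by metis
      then show ?thesis by simp
    qed
    then show ?thesis using True by simp
  next
    case False
    then have "norm (f' h $ i) \<le> (4 * B / r) * norm h" for i
      using comp \<open>0 \<le> B\<close> by simp
    then have "norm (f' h) \<le> CARD('m) * ((4 * B / r) * norm h)"
      by (rule norm_le_card_mult_component)
    then show ?thesis by (simp only: mult.assoc)
  qed
qed

text \<open>
  An explicit holomorphic inverse replaces \<open>inv_into\<close>, with which it agrees only on the open target.
\<close>

lemma biholomorphismI:
  assumes "open S" "open T" "holomorphic_map_on f S" "holomorphic_map_on g T"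
    and "\<And>z. z \<in> S \<Longrightarrow> f z \<in> T" "\<And>w. w \<in> T \<Longrightarrow> g w \<in> S"
    and "\<And>z. z \<in> S \<Longrightarrow> g (f z) = z" "\<And>w. w \<in> T \<Longrightarrow> f (g w) = w"
  shows "biholomorphism S T f"
proof -
  have bij: "bij_betw f S T"
    by (rule bij_betw_byWitness[of _ g]) (use assms in auto)
  have "g w = inv_into S f w" if "w \<in> T" for w
    using bij assms that by (metis bij_betw_inv_into_left)
  then have "holomorphic_map_on (inv_into S f) T"
    using holomorphic_map_on_cong[OF \<open>open T\<close> assms(4)] by blast
  with bij assms show ?thesis by (simp add: biholomorphism_def)
qed

lemma biholomorphism_trans:
  assumes f: "biholomorphism S T f" and g: "biholomorphism T U g" and "open S" "open U"
  shows "biholomorphism S U (g \<circ> f)"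
proof (rule biholomorphismI)
  have *: "bij_betw f S T" "bij_betw g T U" using f g by (auto simp: biholomorphism_def)
  show "holomorphic_map_on (g \<circ> f) S"
    by (rule holomorphic_map_on_compose[where T = T])
       (use f g * in \<open>auto simp: biholomorphism_def bij_betw_apply\<close>)
  show "holomorphic_map_on (inv_into S f \<circ> inv_into T g) U"
    by (rule holomorphic_map_on_compose[where T = T])
       (use f g * bij_betw_inv_into[OF *(2)] in \<open>auto simp: biholomorphism_def bij_betw_apply\<close>)
  show "(g \<circ> f) z \<in> U" if "z \<in> S" for z using * that by (auto simp: bij_betw_apply)
  show "(inv_into S f \<circ> inv_into T g) w \<in> S" if "w \<in> U" for w
    using bij_betw_inv_into[OF *(1)] bij_betw_inv_into[OF *(2)] that by (auto simp: bij_betw_apply)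
  show "(inv_into S f \<circ> inv_into T g) ((g \<circ> f) z) = z" if "z \<in> S" for z
    using * that by (simp add: bij_betw_apply bij_betw_inv_into_left)
  show "(g \<circ> f) ((inv_into S f \<circ> inv_into T g) w) = w" if "w \<in> U" for w
    using * bij_betw_inv_into[OF *(2)] that by (simp add: bij_betw_apply bij_betw_inv_into_right)
qed (use assms in auto)

section \<open>Locally bounded sequences of holomorphic maps\<close>

text \<open>
  The index from which the maps are holomorphic and bounded may depend on the point. This is needed
  for the inverses of the scaled automorphisms, which are defined on domains that only exhaust
  the limit domain.
\<close>

definition locally_bounded_holomorphic ::
    "(nat \<Rightarrow> complex ^ 'n \<Rightarrow> complex ^ 'm) \<Rightarrow> (complex ^ 'n) set \<Rightarrow> bool"
  where "locally_bounded_holomorphic f S \<longleftrightarrow>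
    (\<forall>z\<in>S. \<exists>r>0. \<exists>B. \<forall>\<^sub>F n in sequentially.
       holomorphic_map_on (f n) (ball z r) \<and> (\<forall>w\<in>ball z r. norm (f n w) \<le> B))"

lemma locally_bounded_holomorphic_subseq:
  assumes "locally_bounded_holomorphic f S" and "strict_mono k"
  shows "locally_bounded_holomorphic (\<lambda>n. f (k n)) S"
  using assms(1) eventually_subseq[OF assms(2)] unfolding locally_bounded_holomorphic_def by meson

lemma half_ball_subset_ball:
  fixes z :: "'a::metric_space"
  assumes "w \<in> ball z (r / 2)"
  shows "ball w (r / 2) \<subseteq> ball z r"
proof
  fix v assume "v \<in> ball w (r / 2)"
  with assms dist_triangle[of z v w] show "v \<in> ball z r" by simp
qed

text \<open>
  On half the ball the Cauchy estimate bounds all derivatives by one constant, and the mean value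
  inequality turns this into a Lipschitz bound.
\<close>

lemma locally_equi_Lipschitz:
  fixes f :: "nat \<Rightarrow> complex ^ 'n \<Rightarrow> complex ^ 'm"
  assumes "locally_bounded_holomorphic f S" and "z \<in> S"
  obtains r L where "0 < r" and "0 < L"
    and "\<forall>\<^sub>F n in sequentially. \<forall>x\<in>ball z r. \<forall>y\<in>ball z r. norm (f n x - f n y) \<le> L * norm (x - y)"
proof -
  obtain r B where "0 < r" and
    ev: "\<forall>\<^sub>F n in sequentially. holomorphic_map_on (f n) (ball z r) \<and> (\<forall>w\<in>ball z r. norm (f n w) \<le> B)"
    using assms unfolding locally_bounded_holomorphic_def by meson
  define L where "L = CARD('m) * (4 * \<bar>B\<bar> / (r / 2)) + 1"
  have "0 < L" using \<open>0 < r\<close> by (auto simp: L_def intro!: add_nonneg_pos)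
  moreover have "\<forall>\<^sub>F n in sequentially. \<forall>x\<in>ball z (r / 2). \<forall>y\<in>ball z (r / 2).
      norm (f n x - f n y) \<le> L * norm (x - y)"
    using ev
  proof (eventually_elim, intro ballI)
    fix n x y assume n: "holomorphic_map_on (f n) (ball z r) \<and> (\<forall>w\<in>ball z r. norm (f n w) \<le> B)"
      and x: "x \<in> ball z (r / 2)" and y: "y \<in> ball z (r / 2)"
    show "norm (f n x - f n y) \<le> L * norm (x - y)"
    proof (rule differentiable_bound[OF convex_ball _ _ x y])
      fix w assume w: "w \<in> ball z (r / 2)"
      have sub: "ball w (r / 2) \<subseteq> ball z r"
        using w by (rule half_ball_subset_ball)
      then have "w \<in> ball z r" using \<open>0 < r\<close> by (metis centre_in_ball half_gt_zero subsetD)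
      then have D: "(f n has_derivative frechet_derivative (f n) (at w)) (at w)"
        using n frechet_derivative_at by (metis holomorphic_map_onE)
      then show "(f n has_derivative frechet_derivative (f n) (at w)) (at w within ball z (r / 2))"
        by (rule has_derivative_at_withinI)
      have "norm (frechet_derivative (f n) (at w) h) \<le> L * norm h" for h
      proof -
        have "norm (frechet_derivative (f n) (at w) h)
            \<le> CARD('m) * (4 * \<bar>B\<bar> / (r / 2)) * norm h"
        proof (rule cauchy_estimate[OF _ _ _ D])
          show "holomorphic_map_on (f n) (ball w (r / 2))"
            using n sub holomorphic_map_on_subset by blast
          show "norm (f n v) \<le> \<bar>B\<bar>" if "v \<in> ball w (r / 2)" for v
            using n sub that by force
        qed (use \<open>0 < r\<close> in simp)
        also have "\<dots> \<le> L * norm h" unfolding L_def by (rule mult_right_mono) auto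
        finally show ?thesis .
      qed
      then show "onorm (frechet_derivative (f n) (at w)) \<le> L"
        by (rule onorm_le)
    qed
  qed
  ultimately show ?thesis using that[of "r / 2" L] \<open>0 < r\<close> by simp
qed

text \<open>
  This is what makes pointwise limits compatible with composition: it is applied with \<open>y n\<close> the value
  of another convergent sequence of maps.
\<close>

lemma tendsto_at_moving_point:
  fixes f :: "nat \<Rightarrow> complex ^ 'n \<Rightarrow> complex ^ 'm"
  assumes "locally_bounded_holomorphic f S" and "z \<in> S"
    and y: "y \<longlonglongrightarrow> z" and lim: "(\<lambda>n. f n z) \<longlonglongrightarrow> l"
  shows "(\<lambda>n. f n (y n)) \<longlonglongrightarrow> l"
proof -
  obtain r L where "0 < r" "0 < L" and
    ev: "\<forall>\<^sub>F n in sequentially. \<forall>x\<in>ball z r. \<forall>y\<in>ball z r. norm (f n x - f n y) \<le> L * norm (x - y)"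
    using locally_equi_Lipschitz[OF assms(1,2)] .
  have "(\<lambda>n. f n (y n) - f n z) \<longlonglongrightarrow> 0"
  proof (rule Lim_null_comparison)
    have "\<forall>\<^sub>F n in sequentially. y n \<in> ball z r"
      using topological_tendstoD[OF y open_ball] \<open>0 < r\<close> by simp
    with ev show "\<forall>\<^sub>F n in sequentially. norm (f n (y n) - f n z) \<le> L * norm (y n - z)"
      by eventually_elim (use \<open>0 < r\<close> in auto)
    show "(\<lambda>n. L * norm (y n - z)) \<longlonglongrightarrow> 0"
      using y by (intro tendsto_mult_right_zero tendsto_norm_zero LIM_zero)
  qed
  from tendsto_add[OF this lim] show ?thesis by simp
qed

text \<open>
  Up to errors controlled by the Lipschitz bound, a compact ball is a finite set of points, and on a
  finite set pointwise convergence is uniform.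
\<close>

lemma locally_uniform_limit:
  fixes f :: "nat \<Rightarrow> complex ^ 'n \<Rightarrow> complex ^ 'm"
  assumes f: "locally_bounded_holomorphic f S" and "open S" and "z \<in> S"
    and lim: "\<And>w. w \<in> S \<Longrightarrow> (\<lambda>n. f n w) \<longlonglongrightarrow> g w"
  obtains r where "0 < r" and "uniform_limit (cball z r) f g sequentially"
proof -
  obtain r L where "0 < r" "0 < L" and
    ev: "\<forall>\<^sub>F n in sequentially. \<forall>x\<in>ball z r. \<forall>y\<in>ball z r. norm (f n x - f n y) \<le> L * norm (x - y)"
    using locally_equi_Lipschitz[OF f \<open>z \<in> S\<close>] .
  obtain r' where "0 < r'" "ball z r' \<subseteq> S"
    using \<open>open S\<close> \<open>z \<in> S\<close> open_contains_ball by blast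
  define s where "s = min r r' / 2"
  have "0 < s" and sub: "cball z s \<subseteq> ball z r" "cball z s \<subseteq> S"
    using \<open>0 < r\<close> \<open>0 < r'\<close> \<open>ball z r' \<subseteq> S\<close> by (auto simp: s_def subset_iff)
  have Lg: "norm (g x - g y) \<le> L * norm (x - y)" if "x \<in> cball z s" "y \<in> cball z s" for x y
  proof (rule tendsto_upperbound)
    show "(\<lambda>n. norm (f n x - f n y)) \<longlonglongrightarrow> norm (g x - g y)"
      using that sub by (intro tendsto_intros lim) auto
    show "\<forall>\<^sub>F n in sequentially. norm (f n x - f n y) \<le> L * norm (x - y)"
      using ev by eventually_elim (use that sub in blast)
  qed simp
  have "uniform_limit (cball z s) f g sequentially"
  proof (rule uniform_limitI)
    fix e :: real assume "0 < e"
    define d where "d = e / (3 * L)"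
    have "0 < d" and Ld: "L * d = e / 3" using \<open>0 < e\<close> \<open>0 < L\<close> by (auto simp: d_def)
    have "cball z s \<subseteq> (\<Union>c\<in>cball z s. ball c d)" using \<open>0 < d\<close> by auto
    then obtain C where "finite C" and C: "C \<subseteq> cball z s" "cball z s \<subseteq> (\<Union>c\<in>C. ball c d)"
      by (rule compactE_image[OF compact_cball, rotated]) auto
    have "\<forall>\<^sub>F n in sequentially. \<forall>c\<in>C. dist (f n c) (g c) < e / 3"
      unfolding eventually_ball_finite_distrib[OF \<open>finite C\<close>]
      using C sub \<open>0 < e\<close> by (intro ballI tendstoD lim) auto
    then show "\<forall>\<^sub>F n in sequentially. \<forall>x\<in>cball z s. dist (f n x) (g x) < e"
      using ev
    proof (eventually_elim, intro ballI)
      fix n x assume nC: "\<forall>c\<in>C. dist (f n c) (g c) < e / 3"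
        and nL: "\<forall>x\<in>ball z r. \<forall>y\<in>ball z r. norm (f n x - f n y) \<le> L * norm (x - y)"
        and x: "x \<in> cball z s"
      obtain c where "c \<in> C" and c: "dist c x < d" using C x by auto
      have cx: "L * norm (x - c) < e / 3"
        using c \<open>0 < L\<close> unfolding Ld[symmetric] by (simp add: dist_norm norm_minus_commute)
      have "c \<in> cball z s" using C \<open>c \<in> C\<close> by blast
      then have "norm (f n x - f n c) \<le> L * norm (x - c)" using nL x sub by blast
      then have "dist (f n x) (f n c) < e / 3" using cx by (simp add: dist_norm)
      moreover have "dist (g c) (g x) < e / 3"
        using Lg[OF \<open>c \<in> cball z s\<close> x] cx by (simp add: dist_norm norm_minus_commute)
      moreover have "dist (f n c) (g c) < e / 3" using nC \<open>c \<in> C\<close> by blast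
      ultimately show "dist (f n x) (g x) < e"
        using dist_triangle[of "f n x" "g x" "f n c"] dist_triangle[of "f n c" "g x" "g c"]
        by linarith
    qed
  qed
  with \<open>0 < s\<close> that show ?thesis by blast
qed

text \<open>
  The Cauchy estimate for the differences \<open>F m - F n\<close> shows that the derivatives are uniformly Cauchy
  on a smaller ball. Differentiating the limit termwise gives a Frechet derivative that
  is a limit of complex linear maps.
\<close>

lemma holomorphic_map_on_limit:
  fixes f :: "nat \<Rightarrow> complex ^ 'n \<Rightarrow> complex ^ 'm"
  assumes f: "locally_bounded_holomorphic f S" and "open S"
    and lim: "\<And>w. w \<in> S \<Longrightarrow> (\<lambda>n. f n w) \<longlonglongrightarrow> g w"
  shows "holomorphic_map_on g S"
  unfolding holomorphic_map_on_def
proof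
  fix z assume "z \<in> S"
  obtain r1 where "0 < r1" and unif: "uniform_limit (cball z r1) f g sequentially"
    using locally_uniform_limit[OF f \<open>open S\<close> \<open>z \<in> S\<close> lim] .
  obtain r2 B where "0 < r2" and
    ev: "\<forall>\<^sub>F n in sequentially. holomorphic_map_on (f n) (ball z r2) \<and> (\<forall>w\<in>ball z r2. norm (f n w) \<le> B)"
    using f \<open>z \<in> S\<close> unfolding locally_bounded_holomorphic_def by meson
  obtain r3 where "0 < r3" "ball z r3 \<subseteq> S"
    using \<open>open S\<close> \<open>z \<in> S\<close> open_contains_ball by blast
  define r where "r = min r1 (min r2 r3)"
  have "0 < r" and r: "ball z r \<subseteq> cball z r1" "ball z r \<subseteq> ball z r2" "ball z r \<subseteq> S"
    using \<open>0 < r1\<close> \<open>0 < r2\<close> \<open>0 < r3\<close> \<open>ball z r3 \<subseteq> S\<close> by (auto simp: r_def subset_iff)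
  obtain N where N: "\<And>n. n \<ge> N \<Longrightarrow> holomorphic_map_on (f n) (ball z r2)"
    using ev unfolding eventually_sequentially by blast
  \<comment> \<open>drop the initial terms, which may fail to be holomorphic\<close>
  define F where "F n = f (n + N)" for n
  define D where "D n x = frechet_derivative (F n) (at x)" for n x
  have holF: "holomorphic_map_on (F n) (ball z r)" for n
    unfolding F_def using N r holomorphic_map_on_subset le_add2 by metis
  have D: "(F n has_derivative D n x) (at x)" "D n x (c *s h) = c *s D n x h" if "x \<in> ball z r" for n x c h
    using holF[of n] that unfolding D_def by (metis holomorphic_map_onE frechet_derivative_at)+
  have unifF: "\<forall>\<^sub>F n in sequentially. \<forall>x\<in>ball z r. dist (F n x) (g x) < e" if "0 < e" for e
  proof -
    have "\<forall>\<^sub>F n in sequentially. \<forall>x\<in>cball z r1. dist (f n x) (g x) < e"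
      using unif that by (rule uniform_limitD)
    then have "\<forall>\<^sub>F n in sequentially. \<forall>x\<in>cball z r1. dist (F n x) (g x) < e"
      unfolding F_def by (rule sequentially_offset)
    then show ?thesis by eventually_elim (use r in blast)
  qed
  define K where "K = CARD('m) * (4 / (r / 2))"
  have "0 < K" using \<open>0 < r\<close> by (simp add: K_def)
  have cauchyD: "\<exists>M. \<forall>m\<ge>M. \<forall>n\<ge>M. \<forall>x\<in>ball z (r / 2). \<forall>h. norm (D m x h - D n x h) \<le> e * norm h"
    if "0 < e" for e
  proof -
    define d where "d = e / (2 * K)"
    have "0 < d" and Kd: "K * (2 * d) = e" using \<open>0 < e\<close> \<open>0 < K\<close> by (auto simp: d_def)
    obtain M where M: "\<And>n x. n \<ge> M \<Longrightarrow> x \<in> ball z r \<Longrightarrow> dist (F n x) (g x) < d"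
      using unifF[OF \<open>0 < d\<close>] unfolding eventually_sequentially by blast
    have "norm (D m x h - D n x h) \<le> e * norm h" if "m \<ge> M" "n \<ge> M" "x \<in> ball z (r / 2)" for m n x h
    proof -
      have sub: "ball x (r / 2) \<subseteq> ball z r"
        using that(3) by (rule half_ball_subset_ball)
      then have x: "x \<in> ball z r" using \<open>0 < r\<close> by (metis centre_in_ball half_gt_zero subsetD)
      have "norm (D m x h - D n x h) \<le> CARD('m) * (4 * (2 * d) / (r / 2)) * norm h"
      proof (rule cauchy_estimate)
        show "holomorphic_map_on (\<lambda>y. F m y - F n y) (ball x (r / 2))"
          by (rule holomorphic_map_on_subset[OF holomorphic_map_on_diff[OF holF holF] sub])
        show "norm (F m w - F n w) \<le> 2 * d" if "w \<in> ball x (r / 2)" for w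
          using M[OF \<open>m \<ge> M\<close>, of w] M[OF \<open>n \<ge> M\<close>, of w] that sub dist_triangle2[of "F m w" "F n w" "g w"]
          by (fastforce simp: dist_norm)
        show "((\<lambda>y. F m y - F n y) has_derivative (\<lambda>h. D m x h - D n x h)) (at x)"
          by (intro has_derivative_diff D x)
      qed (use \<open>0 < r\<close> in simp)
      also have "\<dots> = e * norm h" by (simp add: Kd[symmetric] K_def)
      finally show ?thesis .
    qed
    then show ?thesis by blast
  qed
  have convD: "(\<lambda>n. D n x h) \<longlonglongrightarrow> lim (\<lambda>n. D n x h)" if x: "x \<in> ball z (r / 2)" for x h
  proof -
    have "Cauchy (\<lambda>n. D n x h)"
    proof (rule CauchyI)
      fix e :: real assume "0 < e"
      define d where "d = e / (norm h + 1)"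
      have "0 < d" using \<open>0 < e\<close> by (simp add: d_def add_nonneg_pos)
      have "d * norm h < d * (norm h + 1)" using \<open>0 < d\<close> by simp
      also have "\<dots> = e" by (simp add: d_def add_nonneg_eq_0_iff)
      finally have "d * norm h < e" .
      then show "\<exists>M. \<forall>m\<ge>M. \<forall>n\<ge>M. norm (D m x h - D n x h) < e"
        using cauchyD[OF \<open>0 < d\<close>] x by (meson le_less_trans)
    qed
    then show ?thesis using Cauchy_convergent_iff convergent_LIMSEQ_iff by blast
  qed
  define G' where "G' x h = lim (\<lambda>n. D n x h)" for x h
  have "z \<in> ball z (r / 2)" using \<open>0 < r\<close> by simp
  have "\<exists>G. \<forall>x\<in>ball z (r / 2). (\<lambda>n. F n x) \<longlonglongrightarrow> G x \<and> (G has_derivative G' x) (at x within ball z (r / 2))"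
  proof (rule has_derivative_sequence[OF convex_ball _ _ \<open>z \<in> ball z (r / 2)\<close>])
    show "(F n has_derivative D n x) (at x within ball z (r / 2))" if "x \<in> ball z (r / 2)" for n x
      using that D(1)[of x n] \<open>0 < r\<close> by (auto intro!: has_derivative_at_withinI)
    show "(\<lambda>n. F n z) \<longlonglongrightarrow> g z"
      unfolding F_def using lim[OF \<open>z \<in> S\<close>] by (rule LIMSEQ_ignore_initial_segment)
    fix e :: real assume "0 < e"
    then obtain M where M: "\<And>m n x h. m \<ge> M \<Longrightarrow> n \<ge> M \<Longrightarrow> x \<in> ball z (r / 2) \<Longrightarrow>
        norm (D m x h - D n x h) \<le> e * norm h"
      using cauchyD by blast
    have "norm (D n x h - G' x h) \<le> e * norm h" if "n \<ge> M" "x \<in> ball z (r / 2)" for n x h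
    proof (rule tendsto_upperbound)
      show "(\<lambda>m. norm (D n x h - D m x h)) \<longlonglongrightarrow> norm (D n x h - G' x h)"
        unfolding G'_def using that by (intro tendsto_intros convD)
      show "\<forall>\<^sub>F m in sequentially. norm (D n x h - D m x h) \<le> e * norm h"
        using eventually_ge_at_top[of M] by eventually_elim (use M that in blast)
    qed simp
    then show "\<forall>\<^sub>F n in sequentially. \<forall>x\<in>ball z (r / 2). \<forall>h. norm (D n x h - G' x h) \<le> e * norm h"
      unfolding eventually_sequentially by blast
  qed
  then obtain G where G: "\<And>x. x \<in> ball z (r / 2) \<Longrightarrow> (\<lambda>n. F n x) \<longlonglongrightarrow> G x"
      "\<And>x. x \<in> ball z (r / 2) \<Longrightarrow> (G has_derivative G' x) (at x within ball z (r / 2))"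
    by blast
  have "G x = g x" if "x \<in> ball z (r / 2)" for x
  proof (rule LIMSEQ_unique[OF G(1)[OF that]])
    have "x \<in> S" using that r \<open>0 < r\<close> by (auto simp: subset_iff)
    then show "(\<lambda>n. F n x) \<longlonglongrightarrow> g x"
      unfolding F_def using lim LIMSEQ_ignore_initial_segment by blast
  qed
  moreover have Gz: "(G has_derivative G' z) (at z)"
    using G(2)[OF \<open>z \<in> ball z (r / 2)\<close>] at_within_open[OF \<open>z \<in> ball z (r / 2)\<close> open_ball] by simp
  ultimately have gz: "(g has_derivative G' z) (at z)"
    using has_derivative_transform_within_open[OF _ open_ball \<open>z \<in> ball z (r / 2)\<close>] by blast
  moreover have "G' z (c *s h) = c *s G' z h" for c h
  proof (rule LIMSEQ_unique)
    show "(\<lambda>n. D n z (c *s h)) \<longlonglongrightarrow> G' z (c *s h)"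
      unfolding G'_def by (rule convD) fact
    have "(\<lambda>n. c *s D n z h) \<longlonglongrightarrow> c *s G' z h"
      unfolding G'_def vector_scalar_mult_def
      by (intro tendsto_vec_lambda tendsto_mult_left tendsto_vec_nth convD) fact
    then show "(\<lambda>n. D n z (c *s h)) \<longlonglongrightarrow> c *s G' z h"
      using D(2)[of z] \<open>0 < r\<close> by simp
  qed
  moreover have "linear (G' z)" using gz has_derivative_linear by blast
  ultimately show "\<exists>f'. (g has_derivative f') (at z) \<and> Vector_Spaces.linear (*s) (*s) f'"
    by (intro exI[of _ "G' z"])
       (auto simp: Vector_Spaces.linear_iff vec.vector_space_axioms linear_add)
qed

text \<open>
  A diagonal subsequence converges on a countable dense set, and the local Lipschitz bound carries the
  convergence to every other point.
\<close>

theorem Montel_pointwise: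
  fixes f :: "nat \<Rightarrow> complex ^ 'n \<Rightarrow> complex ^ 'm"
  assumes f: "locally_bounded_holomorphic f S"
    and bd: "\<And>n z. z \<in> S \<Longrightarrow> norm (f n z) \<le> M"
  obtains k g where "strict_mono (k :: nat \<Rightarrow> nat)" and "\<forall>z\<in>S. (\<lambda>n. f (k n) z) \<longlonglongrightarrow> g z"
proof -
  obtain T where T: "countable T" "T \<subseteq> S" "S \<subseteq> closure T"
    using separable .
  obtain k :: "nat \<Rightarrow> nat" where k: "strict_mono k" and
    kT: "\<And>t. t \<in> T \<Longrightarrow> \<exists>l. (\<lambda>n. f (k n) t) \<longlonglongrightarrow> l"
    using function_convergent_subsequence[OF \<open>countable T\<close>, of f M] bd T by blast
  have fk: "locally_bounded_holomorphic (\<lambda>n. f (k n)) S"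
    using f k by (rule locally_bounded_holomorphic_subseq)
  have "convergent (\<lambda>n. f (k n) z)" if "z \<in> S" for z
  proof -
    obtain r L where "0 < r" "0 < L" and
      ev: "\<forall>\<^sub>F n in sequentially. \<forall>x\<in>ball z r. \<forall>y\<in>ball z r.
             norm (f (k n) x - f (k n) y) \<le> L * norm (x - y)"
      using locally_equi_Lipschitz[OF fk \<open>z \<in> S\<close>] .
    have "Cauchy (\<lambda>n. f (k n) z)"
    proof (rule metric_CauchyI)
      fix e :: real assume "0 < e"
      define d where "d = min r (e / (3 * L))"
      have "0 < d" using \<open>0 < r\<close> \<open>0 < e\<close> \<open>0 < L\<close> by (simp add: d_def)
      then obtain t where "t \<in> T" and t: "dist t z < d"
        using T \<open>z \<in> S\<close> by (meson closure_approachable subsetD)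
      have "L * dist t z < L * (e / (3 * L))"
        using t \<open>0 < L\<close> by (intro mult_strict_left_mono) (auto simp: d_def)
      then have Lt: "L * dist t z < e / 3" using \<open>0 < L\<close> by simp
      obtain N1 where N1: "\<And>n. n \<ge> N1 \<Longrightarrow> dist (f (k n) t) (f (k n) z) < e / 3"
      proof -
        have "\<forall>\<^sub>F n in sequentially. dist (f (k n) t) (f (k n) z) < e / 3"
          using ev
        proof eventually_elim
          case (elim n)
          have "t \<in> ball z r" "z \<in> ball z r" using t \<open>0 < r\<close> by (auto simp: d_def dist_commute)
          then have "norm (f (k n) t - f (k n) z) \<le> L * norm (t - z)" using elim by blast
          then show ?case using Lt by (simp add: dist_norm)
        qed
        then show ?thesis using that unfolding eventually_sequentially by blast
      qed
      have "Cauchy (\<lambda>n. f (k n) t)" using kT[OF \<open>t \<in> T\<close>] LIMSEQ_imp_Cauchy by blast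
      then obtain N2 where N2: "\<And>m n. m \<ge> N2 \<Longrightarrow> n \<ge> N2 \<Longrightarrow> dist (f (k m) t) (f (k n) t) < e / 3"
        using metric_CauchyD[of _ "e / 3"] \<open>0 < e\<close> by (metis zero_less_divide_iff zero_less_numeral)
      have "dist (f (k m) z) (f (k n) z) < e" if "m \<ge> max N1 N2" "n \<ge> max N1 N2" for m n
        using N1[of m] N1[of n] N2[of m n] that
          dist_triangle[of "f (k m) z" "f (k n) z" "f (k m) t"]
          dist_triangle[of "f (k m) t" "f (k n) z" "f (k n) t"]
        by (simp add: dist_commute)
      then show "\<exists>M. \<forall>m\<ge>M. \<forall>n\<ge>M. dist (f (k m) z) (f (k n) z) < e" by blast
    qed
    then show ?thesis by (simp add: Cauchy_convergent_iff)
  qed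
  then show ?thesis
    using that[OF k, of "\<lambda>z. lim (\<lambda>n. f (k n) z)"] convergent_LIMSEQ_iff by blast
qed

section \<open>The maximum principle\<close>

text \<open>
  The maximum modulus principle is applied to \<open>exp (- h)\<close> on the complex line through \<open>x\<close> and \<open>z\<close>,
  where \<open>h\<close> is the holomorphic function whose real part is \<open>a \<bullet> f\<close>. Convexity of \<open>S\<close> makes its
  intersection with that line connected.
\<close>

lemma holomorphic_map_on_halfspace_boundary:
  fixes f :: "complex ^ 'n \<Rightarrow> complex ^ 'm"
  assumes f: "holomorphic_map_on f S" and "open S" and "convex S"
    and ge: "\<And>w. w \<in> S \<Longrightarrow> a \<bullet> f z \<le> a \<bullet> f w" and "x \<in> S" and "z \<in> S"
  shows "a \<bullet> f x = a \<bullet> f z"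
proof -
  define line where "line \<zeta> = x + \<zeta> *s (z - x)" for \<zeta> :: complex
  define E where "E = {\<zeta>. line \<zeta> \<in> S}"
  define h where "h \<zeta> = exp (- (\<Sum>i\<in>UNIV. cnj (a $ i) * f (line \<zeta>) $ i))" for \<zeta>
  have "open E"
  proof -
    have "isCont line \<zeta>" for \<zeta>
      unfolding line_def using has_derivative_continuous has_derivative_scale_complex by blast
    then have "open (line -` S)" using \<open>open S\<close> by (intro continuous_open_vimage)
    then show ?thesis by (simp add: E_def vimage_def)
  qed
  have "convex E"
  proof (rule convexI)
    fix \<zeta> \<eta> and u v :: real assume "\<zeta> \<in> E" "\<eta> \<in> E" and uv: "0 \<le> u" "0 \<le> v" "u + v = 1"
    have "line (u *\<^sub>R \<zeta> + v *\<^sub>R \<eta>) = u *\<^sub>R line \<zeta> + v *\<^sub>R line \<eta>"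
    proof (subst vec_eq_iff, rule allI)
      fix i
      have v: "v = 1 - u" using uv(3) by simp
      have line: "line w $ i = x $ i + w * (z $ i - x $ i)" for w by (simp add: line_def algebra_simps)
      show "line (u *\<^sub>R \<zeta> + v *\<^sub>R \<eta>) $ i = (u *\<^sub>R line \<zeta> + v *\<^sub>R line \<eta>) $ i"
        unfolding vector_add_component vector_scaleR_component line
        by (simp add: v scaleR_conv_of_real algebra_simps)
    qed
    then show "u *\<^sub>R \<zeta> + v *\<^sub>R \<eta> \<in> E"
      using convexD[OF \<open>convex S\<close> _ _ uv] \<open>\<zeta> \<in> E\<close> \<open>\<eta> \<in> E\<close> by (simp add: E_def)
  qed
  have "(\<lambda>\<zeta>. f (line \<zeta>) $ i) holomorphic_on E" for i
    using holomorphic_on_slice[OF f] unfolding E_def line_def .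
  then have hol_h: "h holomorphic_on E"
    unfolding h_def by (intro holomorphic_intros)
  have norm_h: "norm (h \<zeta>) = exp (- (a \<bullet> f (line \<zeta>)))" for \<zeta>
    by (simp add: h_def inner_vec_def inner_complex_def Re_sum)
  have ends: "line 0 = x" "line 1 = z" by (simp_all add: line_def vec_eq_iff)
  have "norm (h \<zeta>) \<le> norm (h 1)" if "\<zeta> \<in> E" for \<zeta>
    using ge[of "line \<zeta>"] that by (simp add: norm_h ends E_def)
  moreover have "1 \<in> E" using \<open>z \<in> S\<close> ends by (simp add: E_def)
  ultimately have "h constant_on E"
    using hol_h \<open>open E\<close> convex_connected[OF \<open>convex E\<close>]
    by (intro maximum_modulus_principle[where U = E and \<xi> = 1]) auto
  then have "h 0 = h 1"
    using ends \<open>x \<in> S\<close> \<open>z \<in> S\<close> by (auto simp: constant_on_def E_def)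
  then have "norm (h 0) = norm (h 1)" by simp
  then show ?thesis by (simp add: norm_h ends)
qed

text \<open>
  If \<open>f\<close> met the boundary of \<open>K\<close> at \<open>z\<close>, a supporting functional of \<open>K\<close> at \<open>f z\<close> would be minimal at \<open>z\<close>,
  hence constant along \<open>f\<close>, against the strict inequality at \<open>f x\<close>.
\<close>

lemma holomorphic_map_on_interior_of_convex:
  fixes f :: "complex ^ 'n \<Rightarrow> complex ^ 'm"
  assumes f: "holomorphic_map_on f S" and "open S" and "convex S" and "convex K"
    and fK: "\<And>w. w \<in> S \<Longrightarrow> f w \<in> K" and "x \<in> S" and fx: "f x \<in> interior K" and "z \<in> S"
  shows "f z \<in> interior K"
proof (rule ccontr)
  assume "f z \<notin> interior K"
  moreover have ri: "rel_interior K = interior K"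
    using fx rel_interior_nonempty_interior by blast
  ultimately obtain a where a: "\<And>y. y \<in> K \<Longrightarrow> a \<bullet> f z \<le> a \<bullet> y"
      "\<And>y. y \<in> rel_interior K \<Longrightarrow> a \<bullet> f z < a \<bullet> y"
    using supporting_hyperplane_rel_boundary[OF \<open>convex K\<close> fK[OF \<open>z \<in> S\<close>]] by metis
  have "a \<bullet> f x = a \<bullet> f z"
    by (rule holomorphic_map_on_halfspace_boundary[OF f \<open>open S\<close> \<open>convex S\<close>]) (use assms a in auto)
  with a(2)[of "f x"] fx ri show False by simp
qed

lemma interior_vec_nth_vimage:
  fixes A :: "'a::real_normed_vector set"
  shows "interior {z :: 'a ^ 'n. z $ i \<in> A} = {z. z $ i \<in> interior A}"
proof (intro equalityI subsetI)
  fix z :: "'a ^ 'n" assume "z \<in> interior {z. z $ i \<in> A}"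
  then obtain e where "0 < e" and e: "ball z e \<subseteq> {z. z $ i \<in> A}" unfolding mem_interior by blast
  have "ball (z $ i) e \<subseteq> A"
  proof
    fix u assume u: "u \<in> ball (z $ i) e"
    have "norm (axis i (u - z $ i)) = norm (u - z $ i)"
      by (simp add: norm_vec_def L2_set_def axis_def if_distrib[of norm] if_distrib[of "\<lambda>x. x\<^sup>2"] cong: if_cong)
    then have "z + axis i (u - z $ i) \<in> ball z e" using u by (simp add: dist_norm norm_minus_commute)
    then have "(z + axis i (u - z $ i)) $ i \<in> A" using e by blast
    then show "u \<in> A" by (simp add: axis_def)
  qed
  then show "z \<in> {z. z $ i \<in> interior A}" using \<open>0 < e\<close> by (auto simp: mem_interior)
next
  fix z :: "'a ^ 'n" assume "z \<in> {z. z $ i \<in> interior A}"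
  moreover have "open ((\<lambda>z :: 'a ^ 'n. z $ i) -` interior A)"
    by (rule open_vimage) (auto intro!: continuous_intros)
  ultimately show "z \<in> interior {z. z $ i \<in> A}"
    using interior_maximal[of "(\<lambda>z. z $ i) -` interior A" "{z. z $ i \<in> A}"] interior_subset[of A] by auto
qed

lemma convex_vec_nth_vimage: "convex A \<Longrightarrow> convex {z :: 'a::real_vector ^ 'n. z $ i \<in> A}"
  by (auto simp: convex_def)

section \<open>Convex domains near a flat boundary point\<close>

text \<open>
  A supporting functional at \<open>P\<close> is minimal at \<open>P\<close> on the flat piece of the boundary, which surrounds
  \<open>P\<close> in its hyperplane. It is therefore constant on that piece, so it is a multiple of the functional
  that defines the hyperplane, and its sign tells on which side \<open>\<Omega>\<close> lies.
\<close>

lemma flat_boundary_supporting_halfspace: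
  fixes \<Omega> :: "'a::euclidean_space set"
  assumes "open \<Omega>" and "convex \<Omega>" and P: "P \<in> frontier \<Omega>" and flat: "boundary_flat_near \<Omega> P"
  obtains c e where "c \<noteq> 0" and "0 < e" and "\<And>x. x \<in> \<Omega> \<Longrightarrow> c \<bullet> P < c \<bullet> x"
    and "\<And>x. x \<in> ball P e \<Longrightarrow> c \<bullet> x = c \<bullet> P \<Longrightarrow> x \<in> closure \<Omega>"
proof -
  obtain U a b where "open U" "P \<in> U" "a \<noteq> 0" and U: "frontier \<Omega> \<inter> U = {z. a \<bullet> z = b} \<inter> U"
    using flat unfolding boundary_flat_near_def by blast
  obtain e where "0 < e" and e: "ball P e \<subseteq> U"
    using \<open>open U\<close> \<open>P \<in> U\<close> open_contains_ball by blast
  have "a \<bullet> P = b" using P \<open>P \<in> U\<close> U by blast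
  have closure: "x \<in> closure \<Omega>" if "x \<in> ball P e" "a \<bullet> x = b" for x
    using that U e unfolding frontier_def by blast
  have "P \<in> closure \<Omega>" "P \<notin> \<Omega>"
    using P \<open>open \<Omega>\<close> by (auto simp: frontier_def interior_open)
  have ri: "rel_interior (closure \<Omega>) = \<Omega>"
    using convex_rel_interior_closure[OF \<open>convex \<Omega>\<close>] rel_interior_open[OF \<open>open \<Omega>\<close>] by simp
  obtain c where "c \<noteq> 0" and c: "\<And>y. y \<in> closure \<Omega> \<Longrightarrow> c \<bullet> P \<le> c \<bullet> y"
      "\<And>y. y \<in> \<Omega> \<Longrightarrow> c \<bullet> P < c \<bullet> y"
    using supporting_hyperplane_rel_boundary[OF convex_closure[OF \<open>convex \<Omega>\<close>] \<open>P \<in> closure \<Omega>\<close>]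
      \<open>P \<notin> \<Omega>\<close> ri by metis
  have nonneg: "0 \<le> c \<bullet> v" if "a \<bullet> v = 0" for v
  proof -
    define d where "d = e / (norm v + 1)"
    have "0 < d" using \<open>0 < e\<close> by (simp add: d_def add_nonneg_pos)
    have "d * norm v < d * (norm v + 1)" using \<open>0 < d\<close> by simp
    also have "\<dots> = e" by (simp add: d_def add_nonneg_eq_0_iff)
    finally have "P + d *\<^sub>R v \<in> ball P e" using \<open>0 < d\<close> by (simp add: dist_norm)
    moreover have "a \<bullet> (P + d *\<^sub>R v) = b"
      using that \<open>a \<bullet> P = b\<close> by (simp add: inner_add_right)
    ultimately have "c \<bullet> P \<le> c \<bullet> (P + d *\<^sub>R v)" by (intro c(1) closure)
    then show ?thesis using \<open>0 < d\<close> by (simp add: inner_add_right zero_le_mult_iff)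
  qed
  have orth: "c \<bullet> v = 0" if "a \<bullet> v = 0" for v
    using nonneg[OF that] nonneg[of "- v"] that by simp
  \<comment> \<open>the part of \<open>c\<close> orthogonal to \<open>a\<close> is orthogonal to itself\<close>
  define t where "t = (c \<bullet> a) / (a \<bullet> a)"
  define v where "v = c - t *\<^sub>R a"
  have "a \<bullet> v = 0"
    using \<open>a \<noteq> 0\<close> by (simp add: v_def t_def inner_diff_right inner_commute)
  moreover from this have "c \<bullet> v = 0" by (rule orth)
  moreover have "v \<bullet> v = c \<bullet> v - t * (a \<bullet> v)" unfolding v_def by (simp add: inner_diff_left)
  ultimately have "v \<bullet> v = 0" by simp
  then have ct: "c = t *\<^sub>R a" by (simp add: v_def)
  then have "t \<noteq> 0" using \<open>c \<noteq> 0\<close> by auto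
  show ?thesis
  proof (rule that[OF \<open>c \<noteq> 0\<close> \<open>0 < e\<close> c(2)])
    fix x assume "x \<in> ball P e" "c \<bullet> x = c \<bullet> P"
    then show "x \<in> closure \<Omega>"
      using closure[of x] \<open>a \<bullet> P = b\<close> \<open>t \<noteq> 0\<close> by (simp add: ct)
  qed
qed

text \<open>
  When \<open>\<Omega>\<close> lies in \<open>Re z\<^sub>1 > 0\<close>, this is the part of the boundary in the complex line \<open>z\<^sub>1 = 0\<close>, read in the
  coordinate \<open>z\<^sub>2\<close>.
\<close>

definition face :: "(complex ^ 2) set \<Rightarrow> complex set"
  where "face \<Omega> = {w. vector [0, w] \<in> closure \<Omega>}"

lemma convex_face:
  assumes "convex \<Omega>"
  shows "convex (face \<Omega>)"
proof (rule convexI)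
  fix x y and u v :: real
  assume "x \<in> face \<Omega>" "y \<in> face \<Omega>" "0 \<le> u" "0 \<le> v" "u + v = 1"
  then have "u *\<^sub>R vector [0, x] + v *\<^sub>R vector [0, y] \<in> closure \<Omega>"
    using convexD[OF convex_closure[OF assms]] by (simp add: face_def)
  moreover have "u *\<^sub>R vector [0, x] + v *\<^sub>R vector [0, y]
      = (vector [0, u *\<^sub>R x + v *\<^sub>R y] :: complex ^ 2)"
    by (simp add: vec_eq_iff forall_2)
  ultimately show "u *\<^sub>R x + v *\<^sub>R y \<in> face \<Omega>" by (simp add: face_def)
qed

text \<open>
  Two uses of convexity. The boundary is flat not only near the origin but near every \<open>(0, w)\<close> with
  \<open>w\<close> in the interior of the face: such a point lies strictly between the origin and another point of
  the face, and the small ball in the hyperplane around the origin can be moved along the segment.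
  A point \<open>z\<close> slightly above this piece of the hyperplane lies on the segment from the interior point
  \<open>x\<close> to a nearby point of the piece, and so is interior itself.
\<close>

lemma near_face_interior:
  fixes \<Omega> :: "(complex ^ 2) set"
  assumes "open \<Omega>" and "convex \<Omega>" and "x \<in> \<Omega>" and pos: "\<And>z. z \<in> \<Omega> \<Longrightarrow> 0 < Re (z $ 1)"
    and "0 < e" and flat: "\<And>z. z \<in> ball 0 e \<Longrightarrow> Re (z $ 1) = 0 \<Longrightarrow> z \<in> closure \<Omega>"
    and w: "w \<in> interior (face \<Omega>)"
  shows "\<forall>\<^sub>F z in nhds (vector [0, w]). 0 < Re (z $ 1) \<longrightarrow> z \<in> \<Omega>"
proof -
  define p :: "complex ^ 2" where "p = vector [0, w]"
  have p1: "p $ 1 = 0" by (simp add: p_def)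
  note convex_cl = convex_closure[OF \<open>convex \<Omega>\<close>]
  have base: "\<forall>\<^sub>F b in nhds p. Re (b $ 1) = 0 \<longrightarrow> b \<in> closure \<Omega>"
  proof -
    have "((\<lambda>s :: real. (1 + s) *\<^sub>R w) \<longlongrightarrow> (1 + 0) *\<^sub>R w) (at_right 0)"
      by (intro tendsto_intros)
    then have "\<forall>\<^sub>F s in at_right 0. (1 + s) *\<^sub>R w \<in> interior (face \<Omega>)"
      using w by (intro topological_tendstoD) auto
    then have "\<forall>\<^sub>F s in at_right 0. 0 < s \<and> (1 + s) *\<^sub>R w \<in> interior (face \<Omega>)"
      by (simp add: eventually_conj eventually_at_right_less)
    then obtain s :: real where "0 < s" and "(1 + s) *\<^sub>R w \<in> interior (face \<Omega>)"
      using eventually_happens'[OF trivial_limit_at_right_real] by blast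
    \<comment> \<open>a point of the face beyond \<open>w\<close>, as seen from the origin\<close>
    then have "vector [0, (1 + s) *\<^sub>R w] \<in> closure \<Omega>"
      using interior_subset[of "face \<Omega>"] by (auto simp: face_def)
    moreover have "vector [0, (1 + s) *\<^sub>R w] = (1 + s) *\<^sub>R p"
      by (simp add: p_def vec_eq_iff forall_2)
    ultimately have sp: "(1 + s) *\<^sub>R p \<in> closure \<Omega>" by simp
    \<comment> \<open>\<open>b\<close> is a convex combination of \<open>(1 + s) *\<^sub>R p\<close> and this point near the origin\<close>
    have "((\<lambda>b. ((1 + s) / s) *\<^sub>R (b - p)) \<longlongrightarrow> ((1 + s) / s) *\<^sub>R (p - p)) (nhds p)"
      by (intro tendsto_intros filterlim_ident)
    then have "\<forall>\<^sub>F b in nhds p. ((1 + s) / s) *\<^sub>R (b - p) \<in> ball 0 e"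
      using \<open>0 < e\<close> by (intro topological_tendstoD) auto
    then show ?thesis
    proof eventually_elim
      case (elim b)
      show ?case
      proof
        assume "Re (b $ 1) = 0"
        then have c: "((1 + s) / s) *\<^sub>R (b - p) \<in> closure \<Omega>" using elim by (intro flat) (simp_all add: p1)
        have "(1 / (1 + s)) *\<^sub>R ((1 + s) *\<^sub>R p) + (s / (1 + s)) *\<^sub>R (((1 + s) / s) *\<^sub>R (b - p)) \<in> closure \<Omega>"
          using \<open>0 < s\<close> by (intro convexD[OF convex_cl sp c]) (auto simp: field_simps)
        then show "b \<in> closure \<Omega>" using \<open>0 < s\<close> by simp
      qed
    qed
  qed
  \<comment> \<open>the line from \<open>x\<close> through \<open>z\<close> meets \<open>Re z\<^sub>1 = 0\<close> in \<open>b z\<close>, and \<open>z = (1 - \<tau> z) *\<^sub>R b z + \<tau> z *\<^sub>R x\<close>\<close>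
  define \<tau> where "\<tau> z = Re (z $ 1) / Re (x $ 1)" for z :: "complex ^ 2"
  define b where "b z = (1 / (1 - \<tau> z)) *\<^sub>R (z - \<tau> z *\<^sub>R x)" for z
  have x1: "0 < Re (x $ 1)" using \<open>x \<in> \<Omega>\<close> by (rule pos)
  have "(\<tau> \<longlongrightarrow> Re (p $ 1) / Re (x $ 1)) (nhds p)"
    unfolding \<tau>_def by (intro tendsto_intros filterlim_ident) (use x1 in auto)
  then have \<tau>: "(\<tau> \<longlongrightarrow> 0) (nhds p)" by (simp add: p1)
  have "(b \<longlongrightarrow> (1 / (1 - 0)) *\<^sub>R (p - 0 *\<^sub>R x)) (nhds p)"
    unfolding b_def by (intro tendsto_intros filterlim_ident \<tau>) auto
  then have "filterlim b (nhds p) (nhds p)" by simp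
  then have "\<forall>\<^sub>F z in nhds p. Re (b z $ 1) = 0 \<longrightarrow> b z \<in> closure \<Omega>"
    using base by (rule eventually_compose_filterlim[rotated])
  moreover have "\<forall>\<^sub>F z in nhds p. \<tau> z < 1"
    using \<tau> by (rule order_tendstoD) simp
  ultimately have "\<forall>\<^sub>F z in nhds p. 0 < Re (z $ 1) \<longrightarrow> z \<in> \<Omega>"
  proof eventually_elim
    case (elim z)
    show ?case
    proof
      assume "0 < Re (z $ 1)"
      then have "0 < \<tau> z" using x1 by (simp add: \<tau>_def)
      have "Re (b z $ 1) = 0" using x1 by (simp add: b_def) (simp add: \<tau>_def)
      then have "b z \<in> closure \<Omega>" using elim by blast
      then have "b z - \<tau> z *\<^sub>R (b z - x) \<in> interior \<Omega>"
        using \<open>x \<in> \<Omega>\<close> \<open>open \<Omega>\<close> \<open>0 < \<tau> z\<close> elim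
        by (intro mem_interior_closure_convex_shrink[OF \<open>convex \<Omega>\<close>]) (auto simp: interior_open)
      moreover have "b z - \<tau> z *\<^sub>R (b z - x) = (1 - \<tau> z) *\<^sub>R b z + \<tau> z *\<^sub>R x"
        by (simp add: algebra_simps)
      moreover have "\<dots> = z" using elim by (simp add: b_def)
      ultimately show "z \<in> \<Omega>" using \<open>open \<Omega>\<close> by (simp add: interior_open)
    qed
  qed
  then show ?thesis by (simp add: p_def)
qed

lemma Riemann_map_convex:
  fixes S :: "complex set"
  assumes "open S" "convex S" "S \<noteq> {}" "S \<noteq> UNIV"
  obtains f g where "f holomorphic_on S" "g holomorphic_on ball 0 1"
    "\<forall>z\<in>S. f z \<in> ball 0 1 \<and> g (f z) = z" "\<forall>u\<in>ball 0 1. g u \<in> S \<and> f (g u) = u"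
  using Riemann_mapping_theorem[of S] convex_imp_simply_connected[OF \<open>convex S\<close>] assms by metis

lemma tendsto_vector_2:
  fixes f g :: "'b \<Rightarrow> 'a::real_normed_vector"
  assumes "(f \<longlongrightarrow> a) F" and "(g \<longlongrightarrow> b) F"
  shows "((\<lambda>x. vector [f x, g x] :: 'a ^ 2) \<longlongrightarrow> vector [a, b]) F"
proof (rule vec_tendstoI)
  fix i :: 2
  have "i = 1 \<or> i = 2" by (rule exhaust_2)
  then show "((\<lambda>x. (vector [f x, g x] :: 'a ^ 2) $ i) \<longlongrightarrow> (vector [a, b] :: 'a ^ 2) $ i) F"
    using assms by auto
qed

section \<open>Scaling along the orbit\<close>

lemma open_bidisc: "open bidisc"
  unfolding bidisc_def by (intro open_Collect_conj open_vimage[unfolded vimage_def] continuous_intros) auto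

text \<open>
  The scaling argument in normalised coordinates. \<open>F j\<close> is \<open>\<phi> j\<close> followed by the stretching and the
  Riemann map \<open>\<psi>\<close> of the half-plane; \<open>N j\<close> undoes the latter two, and \<open>G j\<close> is the inverse of \<open>F j\<close>
  where that makes sense.
\<close>

theorem biholomorphic_bidisc_if_orbit_to_flat_face:
  fixes \<Omega> :: "(complex ^ 2) set" and \<phi> :: "nat \<Rightarrow> complex ^ 2 \<Rightarrow> complex ^ 2"
  assumes "open \<Omega>" and "convex \<Omega>" and "bounded \<Omega>"
    and pos: "\<And>z. z \<in> \<Omega> \<Longrightarrow> 0 < Re (z $ 1)"
    and "0 < e" and flat: "\<And>z. z \<in> ball 0 e \<Longrightarrow> Re (z $ 1) = 0 \<Longrightarrow> z \<in> closure \<Omega>"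
    and \<phi>: "\<And>j. biholomorphism \<Omega> \<Omega> (\<phi> j)" and "x \<in> \<Omega>" and orbit: "(\<lambda>j. \<phi> j x) \<longlonglongrightarrow> 0"
  shows "biholomorphic \<Omega> bidisc"
proof -
  define H where "H = {\<zeta>. 0 < Re \<zeta>}"
  have "open H" "convex H"
    unfolding H_def by (simp_all add: open_halfspace_Re_gt convex_halfspace_Re_gt)
  have "1 \<in> H" "- 1 \<notin> H" by (simp_all add: H_def)
  then have "H \<noteq> {}" "H \<noteq> UNIV" by blast+
  obtain \<psi> \<psi>' where hol_\<psi>: "\<psi> holomorphic_on H" and hol_\<psi>': "\<psi>' holomorphic_on ball 0 1"
    and maps_H: "\<forall>\<zeta>\<in>H. \<psi> \<zeta> \<in> ball 0 1 \<and> \<psi>' (\<psi> \<zeta>) = \<zeta>"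
      "\<forall>u\<in>ball 0 1. \<psi>' u \<in> H \<and> \<psi> (\<psi>' u) = u"
    using Riemann_map_convex[OF \<open>open H\<close> \<open>convex H\<close> \<open>H \<noteq> {}\<close> \<open>H \<noteq> UNIV\<close>] .
  have \<psi>: "\<And>\<zeta>. \<zeta> \<in> H \<Longrightarrow> \<psi> \<zeta> \<in> ball 0 1" "\<And>\<zeta>. \<zeta> \<in> H \<Longrightarrow> \<psi>' (\<psi> \<zeta>) = \<zeta>"
    and \<psi>': "\<And>u. u \<in> ball 0 1 \<Longrightarrow> \<psi>' u \<in> H" "\<And>u. u \<in> ball 0 1 \<Longrightarrow> \<psi> (\<psi>' u) = u"
    using maps_H by blast+
  have cont_\<psi>': "isCont \<psi>' u" if "u \<in> ball 0 1" for u
    using holomorphic_on_imp_continuous_on[OF hol_\<psi>'] that continuous_on_eq_continuous_at[OF open_ball]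
    by blast

  have bij: "bij_betw (\<phi> j) \<Omega> \<Omega>" and hol_\<phi>: "holomorphic_map_on (\<phi> j) \<Omega>"
    and hol_inv: "holomorphic_map_on (inv_into \<Omega> (\<phi> j)) \<Omega>" for j
    using \<phi>[of j] by (auto simp: biholomorphism_def)
  have \<phi>_in: "\<phi> j z \<in> \<Omega>" if "z \<in> \<Omega>" for j z using bij that bij_betw_apply by metis
  have inv_in: "inv_into \<Omega> (\<phi> j) z \<in> \<Omega>" if "z \<in> \<Omega>" for j z
    using bij_betw_inv_into[OF bij] that bij_betw_apply by metis
  have \<phi>_inv: "\<phi> j (inv_into \<Omega> (\<phi> j) z) = z" and inv_\<phi>: "inv_into \<Omega> (\<phi> j) (\<phi> j z) = z"
    if "z \<in> \<Omega>" for j z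
    using bij_betw_inv_into_right[OF bij that] bij_betw_inv_into_left[OF bij that] by auto

  \<comment> \<open>\<open>\<zeta> \<mapsto> (\<zeta> - q j) / \<mu> j\<close> maps the half-plane \<open>H\<close> to itself and the first coordinate of \<open>\<phi> j x\<close> to 1\<close>
  define \<mu> where "\<mu> j = Re (\<phi> j x $ 1)" for j
  define q where "q j = \<i> * of_real (Im (\<phi> j x $ 1))" for j
  have \<mu>_pos: "0 < \<mu> j" for j
    unfolding \<mu>_def using pos \<phi>_in[OF \<open>x \<in> \<Omega>\<close>] by blast
  have Re_q: "Re (q j) = 0" for j by (simp add: q_def)
  have orbit1: "(\<lambda>j. \<phi> j x $ i) \<longlonglongrightarrow> 0" for i
    using tendsto_vec_nth[OF orbit, of i] by simp
  have \<mu>_lim: "(\<lambda>j. of_real (\<mu> j) :: complex) \<longlonglongrightarrow> 0"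
    unfolding \<mu>_def using tendsto_of_real[OF tendsto_Re[OF orbit1]] by simp
  have q_lim: "q \<longlonglongrightarrow> 0"
    unfolding q_def using tendsto_of_real[OF tendsto_Im[OF orbit1[of 1]], where 'a = complex]
    by (intro tendsto_mult_right_zero) simp

  define F where "F j z = (vector [\<psi> ((\<phi> j z $ 1 - q j) / \<mu> j), \<phi> j z $ 2] :: complex ^ 2)" for j z
  define N where "N j u = (vector [q j + \<mu> j * \<psi>' (u $ 1), u $ 2] :: complex ^ 2)" for j and u :: "complex ^ 2"
  define G where "G j u = (if N j u \<in> \<Omega> then inv_into \<Omega> (\<phi> j) (N j u) else x)" for j u
  define T where "T = {u :: complex ^ 2. u $ 1 \<in> ball 0 1 \<and> u $ 2 \<in> interior (face \<Omega>)}"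

  have scaled: "(\<zeta> - q j) / \<mu> j \<in> H" if "\<zeta> \<in> H" for \<zeta> j
    using that \<mu>_pos[of j] by (simp add: H_def Re_q)
  have \<phi>_H: "\<phi> j z $ 1 \<in> H" if "z \<in> \<Omega>" for j z
    using pos[OF \<phi>_in[OF that]] by (simp add: H_def)
  have F1: "F j z $ 1 \<in> ball 0 1" if "z \<in> \<Omega>" for j z
    using \<psi>(1)[OF scaled[OF \<phi>_H[OF that]]] by (simp add: F_def)
  have NF: "N j (F j z) = \<phi> j z" if "z \<in> \<Omega>" for j z
    using \<psi>(2)[OF scaled[OF \<phi>_H[OF that]]] \<mu>_pos[of j]
    by (simp add: N_def F_def vec_eq_iff forall_2)
  have GF: "G j (F j z) = z" if "z \<in> \<Omega>" for j z
    using that by (simp add: G_def NF \<phi>_in inv_\<phi>)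
  have FG: "F j (G j u) = u" if "N j u \<in> \<Omega>" "u $ 1 \<in> ball 0 1" for j u
    using that \<psi>'(2)[OF that(2)] \<mu>_pos[of j]
    by (simp add: G_def F_def \<phi>_inv) (simp add: N_def vec_eq_iff forall_2)
  have G_in: "G j u \<in> \<Omega>" for j u
    using \<open>x \<in> \<Omega>\<close> by (simp add: G_def inv_in)

  have hol_F: "holomorphic_map_on (F j) \<Omega>" for j
  proof -
    have "(\<lambda>\<zeta>. \<psi> ((\<zeta> - q j) / \<mu> j)) holomorphic_on H"
      by (rule holomorphic_on_compose_gen[OF _ hol_\<psi>, unfolded o_def])
         (use \<mu>_pos[of j] scaled in \<open>auto intro!: holomorphic_intros\<close>)
    then have "holomorphic_map_on (\<lambda>z :: complex ^ 2. vector [\<psi> ((z $ 1 - q j) / \<mu> j), z $ 2] :: complex ^ 2)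
        {z. z $ 1 \<in> H \<and> z $ 2 \<in> UNIV}"
      by (rule holomorphic_map_on_pair) (use \<open>open H\<close> in \<open>auto intro!: holomorphic_intros\<close>)
    from holomorphic_map_on_compose[OF hol_\<phi> this] show ?thesis
      unfolding o_def F_def[abs_def] using \<phi>_H by blast
  qed
  have hol_N: "holomorphic_map_on (N j) {u. u $ 1 \<in> ball 0 1 \<and> u $ 2 \<in> UNIV}" for j
    unfolding N_def[abs_def]
    by (rule holomorphic_map_on_pair[where s = "\<lambda>w. w"]) (auto intro!: holomorphic_intros hol_\<psi>')

  obtain R where R: "\<And>z. z \<in> \<Omega> \<Longrightarrow> norm z \<le> R"
    using \<open>bounded \<Omega>\<close> bounded_iff by blast
  have "0 \<le> R" using R[OF \<open>x \<in> \<Omega>\<close>] norm_ge_zero order_trans by blast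
  have F_bd: "norm (F j z) \<le> CARD(2) * (1 + R)" if "z \<in> \<Omega>" for j z
  proof (rule norm_le_card_mult_component)
    fix i :: 2
    have "norm (\<phi> j z $ 2) \<le> R"
      using Finite_Cartesian_Product.norm_nth_le R[OF \<phi>_in[OF that]] order_trans by blast
    then show "norm (F j z $ i) \<le> 1 + R"
      using exhaust_2[of i] F1[OF that, of j] \<open>0 \<le> R\<close> by (auto simp: F_def)
  qed
  have lb_F: "locally_bounded_holomorphic F \<Omega>"
    unfolding locally_bounded_holomorphic_def
  proof
    fix z assume "z \<in> \<Omega>"
    then obtain r where "0 < r" "ball z r \<subseteq> \<Omega>" using \<open>open \<Omega>\<close> open_contains_ball by blast
    then show "\<exists>r>0. \<exists>B. \<forall>\<^sub>F j in sequentially. holomorphic_map_on (F j) (ball z r) \<and>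
        (\<forall>w\<in>ball z r. norm (F j w) \<le> B)"
      using holomorphic_map_on_subset[OF hol_F] F_bd
      by (intro exI[of _ r] conjI exI[of _ "CARD(2) * (1 + R)"] always_eventually) auto
  qed

  have "open T"
    unfolding T_def by (intro open_Collect_conj open_vimage[unfolded vimage_def] continuous_intros) auto
  have "convex T"
    unfolding T_def Collect_conj_eq
    by (intro convex_Int convex_vec_nth_vimage convex_interior convex_face \<open>convex \<Omega>\<close>) auto
  \<comment> \<open>The stretched domains exhaust the product, because \<open>N j u\<close> tends to \<open>(0, z\<^sub>2)\<close> as \<open>j \<rightarrow> \<infinity>\<close> and
      \<open>u \<rightarrow> z\<close>. The product filter yields one neighbourhood of \<open>z\<close> for all large \<open>j\<close>.\<close>
  have N_eventually: "\<exists>r>0. ball z r \<subseteq> T \<and> (\<forall>\<^sub>F j in sequentially. \<forall>u\<in>ball z r. N j u \<in> \<Omega>)"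
    if "z \<in> T" for z
  proof -
    have z: "z $ 1 \<in> ball 0 1" "z $ 2 \<in> interior (face \<Omega>)" using that by (auto simp: T_def)
    have fst: "((\<lambda>p. X (fst p)) \<longlongrightarrow> 0) (sequentially \<times>\<^sub>F nhds z)" if "X \<longlonglongrightarrow> 0" for X :: "nat \<Rightarrow> complex"
      using filterlim_compose[OF that filterlim_fst] .
    have snd: "((\<lambda>p. snd p $ i) \<longlongrightarrow> z $ i) (sequentially \<times>\<^sub>F nhds z)" for i
      by (intro tendsto_vec_nth filterlim_snd)
    have "((\<lambda>p. \<psi>' (snd p $ 1)) \<longlongrightarrow> \<psi>' (z $ 1)) (sequentially \<times>\<^sub>F nhds z)"
      using isCont_tendsto_compose[OF cont_\<psi>'[OF z(1)] snd] .
    then have "((\<lambda>p. N (fst p) (snd p)) \<longlongrightarrow> vector [0 + 0 * \<psi>' (z $ 1), z $ 2]) (sequentially \<times>\<^sub>F nhds z)"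
      unfolding N_def by (intro tendsto_vector_2 tendsto_add tendsto_mult fst snd \<mu>_lim q_lim)
    then have "filterlim (\<lambda>p. N (fst p) (snd p)) (nhds (vector [0, z $ 2])) (sequentially \<times>\<^sub>F nhds z)"
      by simp
    then have "\<forall>\<^sub>F p in sequentially \<times>\<^sub>F nhds z. 0 < Re (N (fst p) (snd p) $ 1) \<longrightarrow> N (fst p) (snd p) \<in> \<Omega>"
      using near_face_interior[OF \<open>open \<Omega>\<close> \<open>convex \<Omega>\<close> \<open>x \<in> \<Omega>\<close> pos \<open>0 < e\<close> flat z(2)]
      by (rule eventually_compose_filterlim[rotated])
    then obtain A B where A: "\<forall>\<^sub>F j in sequentially. A j" and B: "\<forall>\<^sub>F u in nhds z. B u"
      and AB: "\<And>j u. A j \<Longrightarrow> B u \<Longrightarrow> 0 < Re (N j u $ 1) \<longrightarrow> N j u \<in> \<Omega>"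
      unfolding eventually_prod_filter by auto
    have "\<forall>\<^sub>F u in nhds z. B u \<and> u \<in> T"
      using B eventually_nhds_in_open[OF \<open>open T\<close> \<open>z \<in> T\<close>] by (rule eventually_conj)
    then obtain r where "0 < r" and r: "\<And>u. u \<in> ball z r \<Longrightarrow> B u \<and> u \<in> T"
      unfolding eventually_nhds_metric by (auto simp: dist_commute)
    have "N j u \<in> \<Omega>" if "A j" "u \<in> ball z r" for j u
    proof -
      have "u $ 1 \<in> ball 0 1" using r[OF that(2)] by (simp add: T_def)
      then have "0 < Re (N j u $ 1)" using \<psi>'(1) \<mu>_pos[of j] by (simp add: N_def Re_q H_def)
      then show ?thesis using AB that r by blast
    qed
    then have "\<forall>\<^sub>F j in sequentially. \<forall>u\<in>ball z r. N j u \<in> \<Omega>"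
      using A by (auto elim: eventually_mono)
    then show ?thesis using \<open>0 < r\<close> r by blast
  qed
  have lb_G: "locally_bounded_holomorphic G T"
    unfolding locally_bounded_holomorphic_def
  proof
    fix z assume "z \<in> T"
    then obtain r where "0 < r" and rT: "ball z r \<subseteq> T"
      and ev: "\<forall>\<^sub>F j in sequentially. \<forall>u\<in>ball z r. N j u \<in> \<Omega>"
      using N_eventually by blast
    from ev have "\<forall>\<^sub>F j in sequentially. holomorphic_map_on (G j) (ball z r) \<and>
        (\<forall>w\<in>ball z r. norm (G j w) \<le> R)"
    proof eventually_elim
      case (elim j)
      have "holomorphic_map_on (N j) (ball z r)"
        by (rule holomorphic_map_on_subset[OF hol_N]) (use rT in \<open>auto simp: T_def\<close>)
      then have "holomorphic_map_on (inv_into \<Omega> (\<phi> j) \<circ> N j) (ball z r)"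
        using elim by (intro holomorphic_map_on_compose[OF _ hol_inv]) auto
      then have "holomorphic_map_on (G j) (ball z r)"
        by (rule holomorphic_map_on_cong[OF open_ball]) (use elim in \<open>auto simp: G_def\<close>)
      then show ?case using R[OF G_in] by blast
    qed
    then show "\<exists>r>0. \<exists>B. \<forall>\<^sub>F j in sequentially. holomorphic_map_on (G j) (ball z r) \<and>
        (\<forall>w\<in>ball z r. norm (G j w) \<le> B)"
      using \<open>0 < r\<close> by blast
  qed

  obtain k1 f where "strict_mono k1" and f1: "\<forall>z\<in>\<Omega>. (\<lambda>n. F (k1 n) z) \<longlonglongrightarrow> f z"
    using Montel_pointwise[OF lb_F F_bd] .
  obtain k2 g where "strict_mono k2" and g2: "\<forall>u\<in>T. (\<lambda>n. G (k1 (k2 n)) u) \<longlonglongrightarrow> g u"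
    using Montel_pointwise[OF locally_bounded_holomorphic_subseq[OF lb_G \<open>strict_mono k1\<close>] R[OF G_in]] .
  define k where "k n = k1 (k2 n)" for n
  have "strict_mono k"
    using strict_mono_o[OF \<open>strict_mono k1\<close> \<open>strict_mono k2\<close>] by (simp add: k_def[abs_def] o_def)
  note subseq = LIMSEQ_subseq_LIMSEQ[OF _ \<open>strict_mono k\<close>, unfolded o_def]
  note lb_Fk = locally_bounded_holomorphic_subseq[OF lb_F \<open>strict_mono k\<close>]
  note lb_Gk = locally_bounded_holomorphic_subseq[OF lb_G \<open>strict_mono k\<close>]
  have f: "(\<lambda>n. F (k n) z) \<longlonglongrightarrow> f z" if "z \<in> \<Omega>" for z
    using LIMSEQ_subseq_LIMSEQ[OF f1[rule_format, OF that] \<open>strict_mono k2\<close>] by (simp add: k_def o_def)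
  have g: "(\<lambda>n. G (k n) u) \<longlonglongrightarrow> g u" if "u \<in> T" for u
    using g2[rule_format, OF that] by (simp add: k_def)
  have hol_f: "holomorphic_map_on f \<Omega>"
    using holomorphic_map_on_limit[OF lb_Fk \<open>open \<Omega>\<close> f] .
  have hol_g: "holomorphic_map_on g T"
    using holomorphic_map_on_limit[OF lb_Gk \<open>open T\<close> g] .

  have "(\<phi> j x $ 1 - q j) / \<mu> j = 1" for j
  proof -
    have "\<phi> j x $ 1 - q j = \<mu> j" by (simp add: complex_eq_iff q_def \<mu>_def)
    then show ?thesis using \<mu>_pos[of j] by simp
  qed
  then have Fx: "F j x = vector [\<psi> 1, \<phi> j x $ 2]" for j by (simp add: F_def)
  have fx: "f x = vector [\<psi> 1, 0]"
  proof (rule LIMSEQ_unique[OF f[OF \<open>x \<in> \<Omega>\<close>]])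
    show "(\<lambda>n. F (k n) x) \<longlonglongrightarrow> vector [\<psi> 1, 0]"
      unfolding Fx by (intro tendsto_vector_2 tendsto_const subseq orbit1)
  qed
  \<comment> \<open>The first coordinate has to be settled before the second: once its limit is known to lie in the
      open disc, where \<open>\<psi>'\<close> is continuous, \<open>\<phi> (k n) z\<close> tends to a point with first coordinate 0.\<close>
  have f1_in: "f z $ 1 \<in> ball 0 1" if "z \<in> \<Omega>" for z
  proof -
    let ?K = "{u :: complex ^ 2. u $ 1 \<in> cball 0 1}"
    have int: "interior ?K = {u. u $ 1 \<in> ball 0 1}"
      by (simp only: interior_vec_nth_vimage interior_cball)
    have "f z \<in> interior ?K"
    proof (rule holomorphic_map_on_interior_of_convex[OF hol_f \<open>open \<Omega>\<close> \<open>convex \<Omega>\<close> _ _ \<open>x \<in> \<Omega>\<close> _ that])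
      show "f w \<in> ?K" if "w \<in> \<Omega>" for w
      proof -
        have "(\<lambda>n. norm (F (k n) w $ 1)) \<longlonglongrightarrow> norm (f w $ 1)"
          by (intro tendsto_intros f that)
        then have "norm (f w $ 1) \<le> 1"
          by (rule tendsto_upperbound) (use F1[OF that] in \<open>auto intro!: always_eventually less_imp_le\<close>)
        then show ?thesis by simp
      qed
      show "f x \<in> interior ?K"
        using \<psi>(1)[OF \<open>1 \<in> H\<close>] unfolding int by (simp add: fx)
    qed (rule convex_vec_nth_vimage, simp)
    then show ?thesis unfolding int by simp
  qed
  have f2_in: "f z $ 2 \<in> face \<Omega>" if "z \<in> \<Omega>" for z
  proof -
    have "(\<lambda>n. \<psi>' (F (k n) z $ 1)) \<longlonglongrightarrow> \<psi>' (f z $ 1)"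
      by (rule isCont_tendsto_compose[OF cont_\<psi>'[OF f1_in[OF that]]]) (intro tendsto_intros f that)
    from tendsto_vector_2[OF tendsto_add[OF subseq[OF q_lim] tendsto_mult[OF subseq[OF \<mu>_lim] this]]
        tendsto_vec_nth[OF f[OF that]]]
    have "(\<lambda>n. N (k n) (F (k n) z)) \<longlonglongrightarrow> vector [0 + 0 * \<psi>' (f z $ 1), f z $ 2]"
      unfolding N_def .
    then have "(\<lambda>n. \<phi> (k n) z) \<longlonglongrightarrow> vector [0, f z $ 2]" by (simp add: NF that)
    then have "vector [0, f z $ 2] \<in> closure \<Omega>"
      unfolding closure_sequential using \<phi>_in[OF that] by (intro exI[of _ "\<lambda>n. \<phi> (k n) z"]) simp
    then show ?thesis by (simp add: face_def)
  qed
  have "ball 0 e \<subseteq> face \<Omega>"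
  proof
    fix w :: complex assume "w \<in> ball 0 e"
    then have "(vector [0, w] :: complex ^ 2) \<in> ball 0 e"
      by (simp add: norm_vec_def L2_set_def sum_2)
    then show "w \<in> face \<Omega>" unfolding face_def by (auto intro: flat)
  qed
  then have zero_face: "0 \<in> interior (face \<Omega>)" using \<open>0 < e\<close> by (auto simp: mem_interior)
  have f_in: "f z \<in> T" if "z \<in> \<Omega>" for z
  proof -
    let ?K = "{u :: complex ^ 2. u $ 2 \<in> face \<Omega>}"
    have "f z \<in> interior ?K"
      by (rule holomorphic_map_on_interior_of_convex[OF hol_f \<open>open \<Omega>\<close> \<open>convex \<Omega>\<close> _ _ \<open>x \<in> \<Omega>\<close> _ that])
         (use zero_face f2_in in \<open>auto simp: interior_vec_nth_vimage fx
            intro!: convex_vec_nth_vimage convex_face \<open>convex \<Omega>\<close>\<close>)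
    then show ?thesis using f1_in[OF that] by (simp add: T_def interior_vec_nth_vimage)
  qed
  have gf: "g (f z) = z" if "z \<in> \<Omega>" for z
  proof -
    have "(\<lambda>n. G (k n) (F (k n) z)) \<longlonglongrightarrow> g (f z)"
      by (rule tendsto_at_moving_point[OF lb_Gk f_in[OF that] f[OF that] g[OF f_in[OF that]]])
    then show ?thesis using GF[OF that] by (simp add: LIMSEQ_const_iff)
  qed
  have g_in: "g u \<in> \<Omega>" if "u \<in> T" for u
  proof -
    have int: "interior (closure \<Omega>) = \<Omega>"
      using convex_interior_closure[OF \<open>convex \<Omega>\<close>] \<open>open \<Omega>\<close> by (simp add: interior_open)
    have "g u \<in> interior (closure \<Omega>)"
    proof (rule holomorphic_map_on_interior_of_convex[OF hol_g \<open>open T\<close> \<open>convex T\<close>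
          convex_closure[OF \<open>convex \<Omega>\<close>] _ f_in[OF \<open>x \<in> \<Omega>\<close>] _ that])
      show "g v \<in> closure \<Omega>" if "v \<in> T" for v
        unfolding closure_sequential
        using g[OF that] G_in by (intro exI[of _ "\<lambda>n. G (k n) v"]) simp
      show "g (f x) \<in> interior (closure \<Omega>)" using int gf[OF \<open>x \<in> \<Omega>\<close>] \<open>x \<in> \<Omega>\<close> by simp
    qed
    then show ?thesis by (simp add: int)
  qed
  have fg: "f (g u) = u" if u: "u \<in> T" for u
  proof -
    have "(\<lambda>n. F (k n) (G (k n) u)) \<longlonglongrightarrow> f (g u)"
      by (rule tendsto_at_moving_point[OF lb_Fk g_in[OF u] g[OF u] f[OF g_in[OF u]]])
    moreover have "\<forall>\<^sub>F n in sequentially. F (k n) (G (k n) u) = u"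
    proof -
      obtain r where "0 < r" "\<forall>\<^sub>F j in sequentially. \<forall>v\<in>ball u r. N j v \<in> \<Omega>"
        using N_eventually[OF u] by blast
      then have "\<forall>\<^sub>F j in sequentially. N j u \<in> \<Omega>" by (auto elim: eventually_mono)
      then have "\<forall>\<^sub>F j in sequentially. F j (G j u) = u"
        by (rule eventually_mono) (use u in \<open>auto simp: T_def intro!: FG\<close>)
      then show ?thesis by (rule eventually_subseq[OF \<open>strict_mono k\<close>])
    qed
    ultimately have "(\<lambda>n. u) \<longlonglongrightarrow> f (g u)" by (rule Lim_transform_eventually)
    then show ?thesis by (simp add: LIMSEQ_const_iff)
  qed
  have \<Omega>T: "biholomorphism \<Omega> T f"
    by (rule biholomorphismI[OF \<open>open \<Omega>\<close> \<open>open T\<close> hol_f hol_g f_in g_in gf fg])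

  \<comment> \<open>the Riemann mapping theorem needs the interior of the face to be a proper subset of the plane\<close>
  have "face \<Omega> \<subseteq> cball 0 R"
  proof
    fix w assume "w \<in> face \<Omega>"
    then have "(vector [0, w] :: complex ^ 2) \<in> closure \<Omega>" by (simp add: face_def)
    then have "norm (vector [0, w] :: complex ^ 2) \<le> R"
      using closure_minimal[of \<Omega> "cball 0 R"] R by (auto simp: subset_iff)
    then show "w \<in> cball 0 R" by (simp add: norm_vec_def L2_set_def sum_2)
  qed
  then have "bounded (interior (face \<Omega>))"
    using bounded_subset[OF bounded_cball] interior_subset by (metis order_trans)
  then have proper: "interior (face \<Omega>) \<noteq> UNIV" by auto
  have nonempty: "interior (face \<Omega>) \<noteq> {}" using zero_face by blast
  obtain \<rho> \<rho>' where hol: "\<rho> holomorphic_on interior (face \<Omega>)" "\<rho>' holomorphic_on ball 0 1"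
    and maps_face: "\<forall>\<zeta>\<in>interior (face \<Omega>). \<rho> \<zeta> \<in> ball 0 1 \<and> \<rho>' (\<rho> \<zeta>) = \<zeta>"
      "\<forall>u\<in>ball 0 1. \<rho>' u \<in> interior (face \<Omega>) \<and> \<rho> (\<rho>' u) = u"
    using Riemann_map_convex[OF open_interior convex_interior[OF convex_face[OF \<open>convex \<Omega>\<close>]]
        nonempty proper] .
  have \<rho>: "\<And>\<zeta>. \<zeta> \<in> interior (face \<Omega>) \<Longrightarrow> \<rho> \<zeta> \<in> ball 0 1" "\<And>\<zeta>. \<zeta> \<in> interior (face \<Omega>) \<Longrightarrow> \<rho>' (\<rho> \<zeta>) = \<zeta>"
    and \<rho>': "\<And>u. u \<in> ball 0 1 \<Longrightarrow> \<rho>' u \<in> interior (face \<Omega>)" "\<And>u. u \<in> ball 0 1 \<Longrightarrow> \<rho> (\<rho>' u) = u"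
    using maps_face by blast+
  have "biholomorphism T bidisc (\<lambda>u. vector [u $ 1, \<rho> (u $ 2)])"
  proof (rule biholomorphismI[where g = "\<lambda>v. vector [v $ 1, \<rho>' (v $ 2)]"])
    show "holomorphic_map_on (\<lambda>u :: complex ^ 2. vector [u $ 1, \<rho> (u $ 2)] :: complex ^ 2) T"
      unfolding T_def by (rule holomorphic_map_on_pair[where p = "\<lambda>\<zeta>. \<zeta>"])
        (auto intro!: holomorphic_intros hol)
    show "holomorphic_map_on (\<lambda>v :: complex ^ 2. vector [v $ 1, \<rho>' (v $ 2)] :: complex ^ 2) bidisc"
      unfolding bidisc_def by (rule holomorphic_map_on_pair[where p = "\<lambda>\<zeta>. \<zeta>"])
        (auto intro!: holomorphic_intros hol)
  qed (use \<open>open T\<close> open_bidisc \<rho> \<rho>' in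
      \<open>auto simp: T_def bidisc_def vec_eq_iff forall_2 simp del: mem_ball\<close>)
  then show ?thesis
    using biholomorphism_trans[OF \<Omega>T _ \<open>open \<Omega>\<close> open_bidisc] unfolding biholomorphic_def by blast
qed

section \<open>Normalising the supporting hyperplane\<close>

lemma linear_complex_matrix: "linear ((*v) (A :: complex ^ 'n ^ 'm))"
proof (rule linearI)
  show "A *v (x + y) = A *v x + A *v y" for x y by (rule matrix_vector_right_distrib)
  show "A *v (r *\<^sub>R x) = r *\<^sub>R (A *v x)" for r x
    by (simp add: matrix_vector_mult_def vec_eq_iff scaleR_right.sum)
qed

lemma holomorphic_map_on_matrix_affine:
  fixes A :: "complex ^ 'n ^ 'm"
  shows "holomorphic_map_on (\<lambda>z. A *v (z - p) + q) S"
proof (rule holomorphic_map_onI[where f' = "\<lambda>_ h. A *v h"])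
  have "bounded_linear ((*v) A)"
    using linear_complex_matrix by (simp add: linear_conv_bounded_linear)
  then show "((\<lambda>z. A *v (z - p) + q) has_derivative (*v) A) (at z)" for z
    by (auto intro!: derivative_eq_intros bounded_linear.has_derivative[of "(*v) A"])
  show "A *v (c *s h) = c *s (A *v h)" for c h
    by (simp add: vector_scalar_commute)
qed

theorem theorem13:
  fixes \<Omega> :: "(complex ^ 2) set" and P :: "complex ^ 2"
  assumes "is_domain \<Omega>"
    and "smoothly_bounded \<Omega>"
    and "convex \<Omega>"
    and "P \<in> frontier \<Omega>"
    and "boundary_flat_near \<Omega> P"
    and "boundary_orbit_accumulation_point \<Omega> P"
  shows "biholomorphic \<Omega> bidisc"
proof -
  have "open \<Omega>" "bounded \<Omega>"
    using assms by (auto simp: is_domain_def smoothly_bounded_def)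
  obtain x \<phi> where "x \<in> \<Omega>" and \<phi>: "\<And>j. biholomorphism \<Omega> \<Omega> (\<phi> j)" and orbit: "(\<lambda>j. \<phi> j x) \<longlonglongrightarrow> P"
    using assms(6) unfolding boundary_orbit_accumulation_point_def by blast
  obtain c e where "c \<noteq> 0" and "0 < e" and side: "\<And>z. z \<in> \<Omega> \<Longrightarrow> c \<bullet> P < c \<bullet> z"
    and flat: "\<And>z. z \<in> ball P e \<Longrightarrow> c \<bullet> z = c \<bullet> P \<Longrightarrow> z \<in> closure \<Omega>"
    using flat_boundary_supporting_halfspace[OF \<open>open \<Omega>\<close> \<open>convex \<Omega>\<close> assms(4,5)] by blast

  \<comment> \<open>The real part of the Hermitian product with \<open>c\<close> is \<open>c \<bullet> z\<close>, so the first row turns the hyperplane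
      into \<open>Re z\<^sub>1 = 0\<close>. The second row is orthogonal to the first and makes the matrix invertible.\<close>
  define A :: "complex ^ 2 ^ 2" where
    "A = vector [vector [cnj (c $ 1), cnj (c $ 2)], vector [- c $ 2, c $ 1]]"
  have "det A = of_real ((norm (c $ 1))\<^sup>2 + (norm (c $ 2))\<^sup>2)"
    by (simp add: A_def det_2 complex_norm_square algebra_simps del: of_real_power)
  moreover have "(norm (c $ 1))\<^sup>2 + (norm (c $ 2))\<^sup>2 \<noteq> 0"
    using \<open>c \<noteq> 0\<close> by (auto simp: vec_eq_iff forall_2 sum_power2_eq_zero_iff)
  ultimately have "det A \<noteq> 0" by (metis of_real_eq_0_iff)
  then obtain B where "A ** B = mat 1" "B ** A = mat 1"
    using invertible_det_nz unfolding invertible_def by blast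
  then have AB: "A *v (B *v u) = u" and BA: "B *v (A *v u) = u" for u
    by (simp_all add: matrix_vector_mul_assoc)
  have A1: "Re ((A *v v) $ 1) = c \<bullet> v" for v
    by (simp add: A_def matrix_vector_mult_def sum_2 inner_vec_def inner_complex_def)

  define M where "M z = A *v (z - P)" for z
  define M' where "M' u = B *v u + P" for u
  have hol_M: "holomorphic_map_on M S" and hol_M': "holomorphic_map_on M' S" for S
    using holomorphic_map_on_matrix_affine[of A P 0 S] holomorphic_map_on_matrix_affine[of B 0 P S]
    by (simp_all add: M_def[abs_def] M'_def[abs_def])
  note cont = holomorphic_map_on_imp_continuous_on[OF hol_M] holomorphic_map_on_imp_continuous_on[OF hol_M']
  have MM': "M (M' u) = u" and M'M: "M' (M z) = z" for u z
    by (simp_all add: M_def M'_def AB BA)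
  have M1: "Re (M z $ 1) = c \<bullet> z - c \<bullet> P" for z
    by (simp add: M_def A1 inner_diff_right)

  define \<Omega>' where "\<Omega>' = M ` \<Omega>"
  have "\<Omega>' = M' -` \<Omega>" unfolding \<Omega>'_def using MM' M'M by (auto simp: image_iff) metis
  then have "open \<Omega>'"
    using continuous_on_open_vimage[OF open_UNIV, of M'] cont(2)[of UNIV] \<open>open \<Omega>\<close> by simp
  have \<Omega>'_eq: "\<Omega>' = (*v) A ` ((\<lambda>z. z - P) ` \<Omega>)" by (auto simp: \<Omega>'_def M_def)
  have "convex \<Omega>'"
    unfolding \<Omega>'_eq using \<open>convex \<Omega>\<close> by (intro convex_linear_image[OF linear_complex_matrix] convex_translation_subtract)
  have "bounded \<Omega>'"
    unfolding \<Omega>'_eq using linear_complex_matrix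
    by (intro bounded_linear_image bounded_translation_minus \<open>bounded \<Omega>\<close>)
       (simp add: linear_conv_bounded_linear)
  have \<Omega>\<Omega>': "biholomorphism \<Omega> \<Omega>' M"
    by (rule biholomorphismI[OF \<open>open \<Omega>\<close> \<open>open \<Omega>'\<close> hol_M hol_M']) (auto simp: \<Omega>'_def MM' M'M)
  have \<Omega>'\<Omega>: "biholomorphism \<Omega>' \<Omega> M'"
    by (rule biholomorphismI[OF \<open>open \<Omega>'\<close> \<open>open \<Omega>\<close> hol_M' hol_M]) (auto simp: \<Omega>'_def MM' M'M)

  have "isCont M' 0"
    using cont(2)[of UNIV] by (simp add: continuous_on_eq_continuous_at)
  moreover have "M' 0 = P" by (simp add: M'_def)
  ultimately obtain d where "0 < d" and d: "\<And>u. dist u 0 < d \<Longrightarrow> dist (M' u) P < e"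
    using \<open>0 < e\<close> unfolding continuous_at_eps_delta by metis
  have "biholomorphic \<Omega>' bidisc"
  proof (rule biholomorphic_bidisc_if_orbit_to_flat_face[OF \<open>open \<Omega>'\<close> \<open>convex \<Omega>'\<close> \<open>bounded \<Omega>'\<close> _ \<open>0 < d\<close>])
    show "0 < Re (u $ 1)" if "u \<in> \<Omega>'" for u
      using that side by (auto simp: \<Omega>'_def M1)
    show "u \<in> closure \<Omega>'" if "u \<in> ball 0 d" "Re (u $ 1) = 0" for u
    proof -
      have "M' u \<in> closure \<Omega>"
      proof (rule flat)
        show "M' u \<in> ball P e" using d[of u] that by (simp add: dist_commute)
        show "c \<bullet> M' u = c \<bullet> P" using M1[of "M' u"] that by (simp add: MM')
      qed
      moreover have "M ` closure \<Omega> \<subseteq> closure \<Omega>'"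
        by (rule image_closure_subset[OF cont(1) closed_closure]) (simp add: \<Omega>'_def closure_subset)
      ultimately show ?thesis using MM' by (metis image_subset_iff)
    qed
    show "biholomorphism \<Omega>' \<Omega>' (M \<circ> (\<phi> j \<circ> M'))" for j
      using biholomorphism_trans[OF biholomorphism_trans[OF \<Omega>'\<Omega> \<phi> \<open>open \<Omega>'\<close> \<open>open \<Omega>\<close>]
          \<Omega>\<Omega>' \<open>open \<Omega>'\<close> \<open>open \<Omega>'\<close>] .
    show "M x \<in> \<Omega>'" using \<open>x \<in> \<Omega>\<close> by (simp add: \<Omega>'_def)
    have "isCont M P" using cont(1)[of UNIV] by (simp add: continuous_on_eq_continuous_at)
    then have "(\<lambda>j. M (\<phi> j x)) \<longlonglongrightarrow> M P" using orbit by (rule isCont_tendsto_compose)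
    then show "(\<lambda>j. (M \<circ> (\<phi> j \<circ> M')) (M x)) \<longlonglongrightarrow> 0" by (simp add: M'M) (simp add: M_def)
  qed
  then show ?thesis
    using biholomorphism_trans[OF \<Omega>\<Omega>' _ \<open>open \<Omega>\<close> open_bidisc] unfolding biholomorphic_def by blast
qed

end
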